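(* Fix a constant $C>0$. For each $N$ let $g\sim\mathcal N(0,I_N)$, let $\mathcal A=\mathcal A_N:\mathbf R^N\to\mathbf R^N$ be a coordinate degree $D=D_N$ algorithm with $\mathbf E\|\mathcal A(g)\|^2\le CN$, and let $\tilde{\mathcal A}$ be its randomized rounding. Let $E=E_N$ be a sequence of energy levels, and assume that one of the following holds as $N\to\infty$: (a) $E=\delta N$ for a fixed $\delta\in(0,1)$, and $D\le o(N)$; (b) $\omega(\log^2 N)\le E\le o(N)$, and $D\le o\big(E/\log^2(N/E)\big)$. Then $\mathbf P\big(\tilde{\mathcal A}(g)\in S(E;g)\big)=o(1)$ as $N\to\infty$.
   Context: $\Sigma_N=\{\pm1\}^N$, and $\|\cdot\|$ is the Euclidean norm on $\mathbf R^N$. For $g\in\mathbf R^N$ and $E\in\mathbf R$, the solution set is $S(E;g)=\{x\in\Sigma_N:|\langle g,x\rangle|\le 2^{-E}\}$. Coordinate degree: let $\gamma_N$ be the standard Normal measure on $\mathbf R^N$. For $J\subseteq[N]=\{1,\dots,N\}$ let $V_J$ be the subspace of those $f\in L^2(\gamma_N)$ such that $f(g)$ depends only on the coordinates $(g_i)_{i\in J}$, and let $V_{\le D}=\mathrm{span}\{V_J: J\subseteq[N],|J|\le D\}$. The coordinate degree of $f\in L^2(\gamma_N)$ is $\min\{D:f\in V_{\le D}\}$. A coordinate degree $D$ algorithm is a measurable map $\mathcal A=(\mathcal A_1,\dots,\mathcal A_N):\mathbf R^N\to\mathbf R^N$ with each $\mathcal A_i\in V_{\le D}$. Randomized rounding: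 let $U_1,\dots,U_N$ be i.i.d. uniform on $[-1,1]$, independent of $g$, and let $\mathrm{sign}(z)=+1$ if $z>0$ and $-1$ if $z\le0$. Then $\tilde{\mathcal A}(g)=\big(\mathrm{sign}(\mathcal A_1(g)-U_1),\dots,\mathrm{sign}(\mathcal A_N(g)-U_N)\big)\in\Sigma_N$. The probability is over both $g$ and $(U_i)$. *)

theory Defs
  imports
    "HOL-Probability.Probability"
    "HOL-Library.Landau_Symbols"
    "HOL-Library.Function_Algebras"
begin

text \<open>
  Vectors of dimension \<open>N\<close> are functions on the index set \<open>{1..N}\<close>, extensional outside it, so that
  \<open>N\<close> can be an ordinary number.
\<close>

definition gauss :: "nat \<Rightarrow> (nat \<Rightarrow> real) measure" where
  "gauss N = (\<Pi>\<^sub>M i\<in>{1..N}. density lborel (\<lambda>x. ennreal (std_normal_density x)))"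

definition Sigma_cube :: "nat \<Rightarrow> (nat \<Rightarrow> real) set" where
  "Sigma_cube N = {1..N} \<rightarrow>\<^sub>E {-1, 1}"

definition solution_set :: "nat \<Rightarrow> real \<Rightarrow> (nat \<Rightarrow> real) \<Rightarrow> (nat \<Rightarrow> real) set" where
  "solution_set N E g = {x \<in> Sigma_cube N. \<bar>\<Sum>i=1..N. g i * x i\<bar> \<le> 2 powr (- E)}"

text \<open>
  Elements of \<open>L\<^sup>2\<close> are represented by functions rather than by classes modulo null sets.  Hence
  dependence on the coordinates in \<open>J\<close> is required almost everywhere only: \<open>V_coord N J\<close> consists of
  all representatives of the classes containing a function of \<open>(g i)\<close>, \<open>i \<in> J\<close>.
\<close>

definition V_coord :: "nat \<Rightarrow> nat set \<Rightarrow> ((nat \<Rightarrow> real) \<Rightarrow> real) set" where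
  "V_coord N J =
     {f. f \<in> borel_measurable (gauss N) \<and> integrable (gauss N) (\<lambda>g. (f g)\<^sup>2) \<and>
         (\<exists>h \<in> borel_measurable (\<Pi>\<^sub>M i\<in>J. borel). AE g in gauss N. f g = h (restrict g J))}"

lemma vector_space_pointwise:
  "vector_space (\<lambda>(c::real) (f :: 'a \<Rightarrow> real) g. c * f g)"
  by unfold_locales (auto simp: fun_eq_iff algebra_simps)

text \<open>
  Linear span in the space of all real functions with pointwise operations.  Since \<open>V_coord\<close> is closed
  under almost everywhere equality, so is \<open>V_le N D\<close>, and it corresponds to the span in \<open>L\<^sup>2\<close>.
\<close>

definition V_le :: "nat \<Rightarrow> nat \<Rightarrow> ((nat \<Rightarrow> real) \<Rightarrow> real) set" where
  "V_le N D =
     module.span (\<lambda>(c::real) f g. c * f g) (\<Union>J \<in> {J. J \<subseteq> {1..N} \<and> card J \<le> D}. V_coord N J)"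

definition coord_degree_algorithm ::
    "nat \<Rightarrow> nat \<Rightarrow> ((nat \<Rightarrow> real) \<Rightarrow> (nat \<Rightarrow> real)) \<Rightarrow> bool" where
  "coord_degree_algorithm N D A \<longleftrightarrow>
     A \<in> measurable (gauss N) (\<Pi>\<^sub>M i\<in>{1..N}. borel) \<and>
     (\<forall>i\<in>{1..N}. (\<lambda>g. A g i) \<in> V_le N D)"

text \<open>Unlike \<^const>\<open>sgn\<close>, this takes the value \<open>-1\<close> at \<open>0\<close>.\<close>

definition rsign :: "real \<Rightarrow> real" where
  "rsign z = (if z > 0 then 1 else -1)"

definition unif_cube :: "nat \<Rightarrow> (nat \<Rightarrow> real) measure" where
  "unif_cube N = (\<Pi>\<^sub>M i\<in>{1..N}. uniform_measure lborel {-1..1})"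

definition rounding ::
    "nat \<Rightarrow> ((nat \<Rightarrow> real) \<Rightarrow> (nat \<Rightarrow> real)) \<Rightarrow> (nat \<Rightarrow> real) \<Rightarrow> (nat \<Rightarrow> real) \<Rightarrow> (nat \<Rightarrow> real)" where
  "rounding N A g u = (\<lambda>i\<in>{1..N}. rsign (A g i - u i))"

text \<open>The product measure is the joint law of \<open>g\<close> and the independent rounding variables.\<close>

definition success_prob ::
    "nat \<Rightarrow> ((nat \<Rightarrow> real) \<Rightarrow> (nat \<Rightarrow> real)) \<Rightarrow> real \<Rightarrow> real" where
  "success_prob N A E =
     \<P>((g, u) in gauss N \<Otimes>\<^sub>M unif_cube N. rounding N A g u \<in> solution_set N E g)"

end

theory Submission
  imports Defs "HOL-Real_Asymp.Real_Asymp"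
begin

text \<open>
  Call \<open>A g\<close> decisive if the expected number \<open>m g\<close> of coordinates in which its rounding differs from its sign
  vector is at most a constant \<open>M\<close>.

  If \<open>A g\<close> is not decisive, its rounding is spread out: with high probability over \<open>g\<close>, no two solutions
  differ in exactly two coordinates, so the one-flip neighbours of the solutions are pairwise distinct, and
  comparing the mass of a solution with that of its neighbours shows that the rounding is a solution with
  probability at most \<open>1 / m g\<close>.

  If \<open>A g\<close> is decisive and its rounding succeeds, the sign vector of \<open>A g\<close> is likely within a bounded
  Hamming distance of a solution.  Call this event \<open>B\<close>, and resample one uniformly random coordinate of \<open>g\<close>
  to obtain \<open>g'\<close>.  By Jensen's inequality \<open>g\<close> and \<open>g'\<close> are both in \<open>B\<close> with probability at least the square
  of that of \<open>B\<close>.  A function of coordinate degree \<open>D\<close> has total influence at most \<open>D\<close> times its second moment,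
  so \<open>A g\<close> and \<open>A g'\<close> have expected squared distance \<open>O(D)\<close>, whatever \<open>N\<close> is.  Hence \<open>g'\<close> has a solution
  within distance \<open>k\<close> of the sign vector of \<open>A g\<close>, for every \<open>k\<close> of larger order than \<open>D\<close>.  But that sign
  vector is independent of the resampled value, and for \<open>k = E / (4 ln (4 N / E))\<close> a union bound over
  the Hamming ball excludes this.
\<close>

section \<open>Total influence of functions of bounded coordinate degree\<close>

lemma abs_mult_le_sum_squares: "\<bar>a * b\<bar> \<le> a\<^sup>2 + b\<^sup>2" for a b :: real
proof -
  have "2 * (\<bar>a\<bar> * \<bar>b\<bar>) \<le> a\<^sup>2 + b\<^sup>2"
    using sum_squares_bound[of "\<bar>a\<bar>" "\<bar>b\<bar>"] by simp
  moreover have "0 \<le> \<bar>a\<bar> * \<bar>b\<bar>" by simp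
  ultimately show ?thesis unfolding abs_mult by linarith
qed

lemma measure_pair_le:
  assumes "prob_space M1" "prob_space M2" "Q \<in> sets (M1 \<Otimes>\<^sub>M M2)" "0 \<le> c"
    and "\<And>x. x \<in> space M1 \<Longrightarrow> measure M2 (Pair x -` Q) \<le> c"
  shows "measure (M1 \<Otimes>\<^sub>M M2) Q \<le> c"
proof -
  interpret M1: prob_space M1 by fact
  interpret M2: prob_space M2 by fact
  have "emeasure (M1 \<Otimes>\<^sub>M M2) Q = (\<integral>\<^sup>+x. emeasure M2 (Pair x -` Q) \<partial>M1)"
    by (rule M2.emeasure_pair_measure_alt[OF assms(3)])
  also have "\<dots> \<le> (\<integral>\<^sup>+x. ennreal c \<partial>M1)"
    using assms(5) by (intro nn_integral_mono) (simp add: M2.emeasure_eq_measure ennreal_leI)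
  also have "\<dots> = ennreal c"
    by (simp add: M1.emeasure_space_1)
  finally show ?thesis
    using assms(4) by (simp add: measure_def enn2real_leI)
qed

section \<open>Resampling one coordinate of a finite i.i.d. vector\<close>

locale iid_product = prob_space \<nu> for \<nu> :: "'b measure" +
  fixes I :: "'i set"
  assumes finite_I: "finite I"
begin

abbreviation PM :: "('i \<Rightarrow> 'b) measure" where
  "PM \<equiv> PiM I (\<lambda>_. \<nu>)"

sublocale PM: prob_space PM
  by (intro prob_space_PiM prob_space_axioms)

sublocale PM_pair: pair_sigma_finite PM \<nu> ..

sublocale PM_pair_prob: prob_space "PM \<Otimes>\<^sub>M \<nu>"
  by (rule prob_space_pair) unfold_locales

sublocale factors: product_sigma_finite "\<lambda>_::'i. \<nu>" ..

lemma fun_upd_measurable [measurable]: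
  assumes "i \<in> I"
  shows "(\<lambda>(g, y). g(i := y)) \<in> PM \<Otimes>\<^sub>M \<nu> \<rightarrow>\<^sub>M PM"
  using measurable_add_dim[of i I "\<lambda>_. \<nu>"] assms by (simp add: insert_absorb)

text \<open>The old value at \<open>i\<close> is discarded and replaced by an independent one of the
  same law. Boxes determine the product measure, and the preimage of a box under the update is again
  a box.\<close>

lemma distr_fun_upd:
  assumes "i \<in> I"
  shows "distr (PM \<Otimes>\<^sub>M \<nu>) PM (\<lambda>(g, y). g(i := y)) = PM"
proof (rule factors.PiM_eqI)
  show "finite I" by (rule finite_I)
  fix A assume A: "\<And>j. j \<in> I \<Longrightarrow> A j \<in> sets \<nu>"
  have sub: "A j \<subseteq> space \<nu>" if "j \<in> I" for j
    using sets.sets_into_space[OF A[OF that]] .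
  \<comment> \<open>The overwritten value is arbitrary, so side \<open>i\<close> becomes the whole
    space and contributes the factor 1.\<close>
  define A' where "A' = A(i := space \<nu>)"
  have A': "\<And>j. j \<in> I \<Longrightarrow> A' j \<in> sets \<nu>" using A by (auto simp: A'_def)
  have "(\<lambda>(g, y). g(i := y)) -` (Pi\<^sub>E I A) \<inter> space (PM \<Otimes>\<^sub>M \<nu>) = Pi\<^sub>E I A' \<times> A i"
  proof (rule set_eqI, clarify)
    fix g :: "'i \<Rightarrow> 'b" and y :: 'b
    have "g(i := y) \<in> extensional I \<longleftrightarrow> g \<in> extensional I"
      using assms by (auto simp: extensional_def)
    moreover have "(\<forall>j\<in>I. (g(i := y)) j \<in> A j) \<longleftrightarrow> (\<forall>j\<in>I - {i}. g j \<in> A j) \<and> y \<in> A i"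
      using assms by auto
    ultimately have "g(i := y) \<in> Pi\<^sub>E I A \<and> (g, y) \<in> space (PM \<Otimes>\<^sub>M \<nu>) \<longleftrightarrow>
        (\<forall>j\<in>I - {i}. g j \<in> A j) \<and> y \<in> A i \<and> g i \<in> space \<nu> \<and> g \<in> extensional I"
      unfolding space_pair_measure space_PiM PiE_iff mem_Times_iff
      using assms sub by (simp, blast)
    also have "\<dots> \<longleftrightarrow> g \<in> Pi\<^sub>E I A' \<and> y \<in> A i"
      using assms unfolding A'_def PiE_iff by (simp add: Ball_def) metis
    finally show "(g, y) \<in> (\<lambda>(g, y). g(i := y)) -` (Pi\<^sub>E I A) \<inter> space (PM \<Otimes>\<^sub>M \<nu>) \<longleftrightarrow>
        (g, y) \<in> Pi\<^sub>E I A' \<times> A i" by simp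
  qed
  then have "emeasure (distr (PM \<Otimes>\<^sub>M \<nu>) PM (\<lambda>(g, y). g(i := y))) (Pi\<^sub>E I A)
      = emeasure (PM \<Otimes>\<^sub>M \<nu>) (Pi\<^sub>E I A' \<times> A i)"
    using A assms finite_I by (subst emeasure_distr) (auto intro!: sets_PiM_I_finite)
  also have "\<dots> = emeasure PM (Pi\<^sub>E I A') * emeasure \<nu> (A i)"
    using A A' assms finite_I by (intro emeasure_pair_measure_Times) (auto intro!: sets_PiM_I_finite)
  also have "emeasure PM (Pi\<^sub>E I A') = (\<Prod>j\<in>I. emeasure \<nu> (A' j))"
    using A' by (intro factors.emeasure_PiM finite_I)
  also have "\<dots> = (\<Prod>j\<in>I - {i}. emeasure \<nu> (A j))"
    using assms finite_I emeasure_space_1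
    by (subst prod.remove[of _ i]) (auto simp: A'_def intro!: prod.cong)
  also have "\<dots> * emeasure \<nu> (A i) = (\<Prod>j\<in>I. emeasure \<nu> (A j))"
    using assms finite_I by (subst (2) prod.remove[of _ i]) (auto simp: mult.commute)
  finally show "emeasure (distr (PM \<Otimes>\<^sub>M \<nu>) PM (\<lambda>(g, y). g(i := y))) (Pi\<^sub>E I A) =
      (\<Prod>j\<in>I. emeasure \<nu> (A j))" .
qed simp

lemma integrable_fun_upd:
  fixes f :: "('i \<Rightarrow> 'b) \<Rightarrow> real"
  assumes "i \<in> I" "integrable PM f"
  shows "integrable (PM \<Otimes>\<^sub>M \<nu>) (\<lambda>(g, y). f (g(i := y)))"
proof -
  have "integrable (distr (PM \<Otimes>\<^sub>M \<nu>) PM (\<lambda>(g, y). g(i := y))) f"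
    using assms by (simp add: distr_fun_upd)
  from integrable_distr[OF fun_upd_measurable[OF assms(1)] this]
  show ?thesis by (simp add: case_prod_unfold)
qed

lemma integral_fun_upd:
  fixes f :: "('i \<Rightarrow> 'b) \<Rightarrow> real"
  assumes "i \<in> I" "f \<in> borel_measurable PM"
  shows "(\<integral>(g, y). f (g(i := y)) \<partial>(PM \<Otimes>\<^sub>M \<nu>)) = (\<integral>g. f g \<partial>PM)"
proof -
  have "(\<integral>g. f g \<partial>PM) = (\<integral>g. f g \<partial>distr (PM \<Otimes>\<^sub>M \<nu>) PM (\<lambda>(g, y). g(i := y)))"
    using assms by (simp add: distr_fun_upd)
  also have "\<dots> = (\<integral>(g, y). f (g(i := y)) \<partial>(PM \<Otimes>\<^sub>M \<nu>))"
    using assms by (subst integral_distr) (auto simp: case_prod_unfold)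
  finally show ?thesis by simp
qed

text \<open>Since resampling preserves the law, null sets pull back to null sets of the product,
  which Fubini splits into sections.\<close>

lemma AE_fun_upd:
  assumes "i \<in> I" "AE g in PM. P g"
  shows "AE g in PM. AE y in \<nu>. P (g(i := y))"
proof -
  have "AE g in distr (PM \<Otimes>\<^sub>M \<nu>) PM (\<lambda>(g, y). g(i := y)). P g"
    using assms(2) by (subst distr_fun_upd[OF assms(1)])
  from AE_distrD[OF fun_upd_measurable[OF assms(1)] this]
  have "AE x in PM \<Otimes>\<^sub>M \<nu>. P ((fst x)(i := snd x))" by (simp add: case_prod_unfold)
  from PM_pair.AE_pair[OF this] show ?thesis by simp
qed

section \<open>Averaging out one coordinate: the conditional expectation given all the
  others\<close>

definition cavg :: "'i \<Rightarrow> (('i \<Rightarrow> 'b) \<Rightarrow> real) \<Rightarrow> ('i \<Rightarrow> 'b) \<Rightarrow> real" where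
  "cavg i f g = (\<integral>y. f (g(i := y)) \<partial>\<nu>)"

definition L2 :: "(('i \<Rightarrow> 'b) \<Rightarrow> real) \<Rightarrow> bool" where
  "L2 f \<longleftrightarrow> f \<in> borel_measurable PM \<and> integrable PM (\<lambda>g. (f g)\<^sup>2)"

lemma L2_measurable [measurable_dest]: "L2 f \<Longrightarrow> f \<in> borel_measurable PM"
  by (simp add: L2_def)

lemma L2_integrable_power2: "L2 f \<Longrightarrow> integrable PM (\<lambda>g. (f g)\<^sup>2)"
  by (simp add: L2_def)

lemma L2_integrable_mult:
  assumes "L2 f" "L2 h"
  shows "integrable PM (\<lambda>g. f g * h g)"
proof (rule Bochner_Integration.integrable_bound)
  show "integrable PM (\<lambda>g. (f g)\<^sup>2 + (h g)\<^sup>2)"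
    using assms by (simp add: L2_def)
  show "(\<lambda>g. f g * h g) \<in> borel_measurable PM"
    using assms by (auto simp: L2_def)
  show "AE g in PM. norm (f g * h g) \<le> norm ((f g)\<^sup>2 + (h g)\<^sup>2)"
    by (simp add: abs_mult_le_sum_squares)
qed

lemma L2_const: "L2 (\<lambda>_. c)"
  by (simp add: L2_def)

lemma L2_integrable: "L2 f \<Longrightarrow> integrable PM f"
  using L2_integrable_mult[OF _ L2_const[of 1], of f] by simp

lemma L2_add:
  assumes "L2 f" "L2 h"
  shows "L2 (\<lambda>g. f g + h g)"
  using assms L2_integrable_mult[OF assms] by (auto simp: L2_def power2_sum mult.assoc)

lemma L2_scale: "L2 f \<Longrightarrow> L2 (\<lambda>g. c * f g)"
  by (auto simp: L2_def power_mult_distrib)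

lemma L2_diff:
  assumes "L2 f" "L2 h"
  shows "L2 (\<lambda>g. f g - h g)"
  using L2_add[OF assms(1) L2_scale[OF assms(2), of "-1"]] by simp

lemma L2_AE_cong:
  assumes "L2 f" "h \<in> borel_measurable PM" "AE g in PM. f g = h g"
  shows "L2 h"
proof -
  have "integrable PM (\<lambda>g. (h g)\<^sup>2)"
    using assms by (subst integrable_cong_AE[where g = "\<lambda>g. (f g)\<^sup>2"]) (auto simp: L2_def)
  then show ?thesis using assms by (simp add: L2_def)
qed

lemma cavg_measurable [measurable]:
  assumes "i \<in> I" "f \<in> borel_measurable PM"
  shows "cavg i f \<in> borel_measurable PM"
proof -
  have "(\<lambda>(g, y). f (g(i := y))) \<in> borel_measurable (PM \<Otimes>\<^sub>M \<nu>)"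
    using measurable_compose[OF fun_upd_measurable[OF assms(1)] assms(2)]
    by (simp add: case_prod_unfold)
  then show ?thesis
    unfolding cavg_def by (rule borel_measurable_lebesgue_integral)
qed

lemma AE_section_integrable:
  fixes f :: "('i \<Rightarrow> 'b) \<Rightarrow> real"
  assumes "i \<in> I" "integrable PM f"
  shows "AE g in PM. integrable \<nu> (\<lambda>y. f (g(i := y)))"
  using PM_pair.AE_integrable_fst'[OF integrable_fun_upd[OF assms]] by simp

lemma integral_cavg:
  assumes "i \<in> I" "integrable PM f"
  shows "(\<integral>g. cavg i f g \<partial>PM) = (\<integral>g. f g \<partial>PM)"
  using PM_pair.integral_fst'[OF integrable_fun_upd[OF assms]] integral_fun_upd[OF assms(1), of f] assms
  by (simp add: cavg_def[abs_def])

lemma integrable_cavg: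
  assumes "i \<in> I" "integrable PM f"
  shows "integrable PM (cavg i f)"
  using PM_pair.integrable_fst'[OF integrable_fun_upd[OF assms]]
  by (simp add: cavg_def[abs_def])

lemma cavg_fun_upd [simp]: "cavg i f (g(i := y)) = cavg i f g"
  by (simp add: cavg_def)

text \<open>\<open>cavg i h\<close> is constant along coordinate \<open>i\<close> and can be pulled
  out of the integral. This works at every \<open>g\<close>: if the section of \<open>f\<close> is
  not integrable, both sides are 0 by convention.\<close>

lemma cavg_mult_cavg: "cavg i (\<lambda>g. cavg i h g * f g) g = cavg i h g * cavg i f g"
  unfolding cavg_def[of i "\<lambda>g. cavg i h g * f g"] by (simp add: cavg_def[of i f])

lemma cavg_AE_cong:
  assumes "i \<in> I" "f \<in> borel_measurable PM" "h \<in> borel_measurable PM" "AE g in PM. f g = h g"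
  shows "AE g in PM. cavg i f g = cavg i h g"
  using AE_fun_upd[OF assms(1,4)] AE_space
proof eventually_elim
  case (elim g)
  have "(\<lambda>y. g(i := y)) \<in> \<nu> \<rightarrow>\<^sub>M PM"
    using measurable_compose[OF measurable_Pair1'[OF elim(2)] fun_upd_measurable[OF assms(1)]] by simp
  from measurable_compose[OF this assms(2)] measurable_compose[OF this assms(3)] elim(1)
  show ?case unfolding cavg_def by (intro integral_cong_AE) auto
qed

text \<open>The integral of a non-integrable section is 0 by default, so additivity may fail at some
  \<open>g\<close>; almost every section is integrable.\<close>

lemma cavg_add:
  assumes "i \<in> I" "integrable PM f" "integrable PM h"
  shows "AE g in PM. cavg i (\<lambda>g. f g + h g) g = cavg i f g + cavg i h g"
  using AE_section_integrable[OF assms(1,2)] AE_section_integrable[OF assms(1,3)]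
  by eventually_elim (simp add: cavg_def)

lemma cavg_diff:
  assumes "i \<in> I" "integrable PM f" "integrable PM h"
  shows "AE g in PM. cavg i (\<lambda>g. f g - h g) g = cavg i f g - cavg i h g"
  using AE_section_integrable[OF assms(1,2)] AE_section_integrable[OF assms(1,3)]
  by eventually_elim (simp add: cavg_def)

text \<open>Nonnegativity of the variance of a section is Jensen's inequality: the square of the
  average is at most the average of the square, which is integrable.\<close>

lemma L2_cavg:
  assumes "i \<in> I" "L2 f"
  shows "L2 (cavg i f)"
proof -
  have "AE g in PM. (cavg i f g)\<^sup>2 \<le> cavg i (\<lambda>g. (f g)\<^sup>2) g"
    using AE_section_integrable[OF assms(1) L2_integrable[OF assms(2)]]
      AE_section_integrable[OF assms(1) L2_integrable_power2[OF assms(2)]]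
  proof eventually_elim
    case (elim g)
    have "0 \<le> variance (\<lambda>y. f (g(i := y)))" by (rule variance_positive)
    then show ?case using variance_eq[OF elim] by (simp add: cavg_def)
  qed
  then have "AE g in PM. norm ((cavg i f g)\<^sup>2) \<le> norm (cavg i (\<lambda>g. (f g)\<^sup>2) g)"
    by eventually_elim simp
  moreover have "(\<lambda>g. (cavg i f g)\<^sup>2) \<in> borel_measurable PM"
    using assms by measurable
  ultimately have "integrable PM (\<lambda>g. (cavg i f g)\<^sup>2)"
    using Bochner_Integration.integrable_bound[OF integrable_cavg[OF assms(1) L2_integrable_power2[OF assms(2)]]]
    by blast
  then show ?thesis using cavg_measurable[OF assms(1) L2_measurable[OF assms(2)]] by (simp add: L2_def)
qed

text \<open>Averaging is an orthogonal projection: conditioning on the other coordinates turns the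
  factor \<open>f\<close> into \<open>cavg i f\<close>. The next lemma is the resulting Pythagorean
  identity.\<close>

lemma integral_mult_cavg:
  assumes "i \<in> I" "L2 f"
  shows "(\<integral>g. f g * cavg i f g \<partial>PM) = (\<integral>g. (cavg i f g)\<^sup>2 \<partial>PM)"
proof -
  have "(\<integral>g. cavg i f g * f g \<partial>PM) = (\<integral>g. cavg i (\<lambda>g. cavg i f g * f g) g \<partial>PM)"
    by (intro integral_cavg[symmetric] assms L2_integrable_mult L2_cavg)
  also have "\<dots> = (\<integral>g. (cavg i f g)\<^sup>2 \<partial>PM)"
    by (simp add: cavg_mult_cavg power2_eq_square)
  finally show ?thesis by (simp add: mult.commute)
qed

lemma integral_diff_cavg:
  assumes "i \<in> I" "L2 f"
  shows "(\<integral>g. (f g - cavg i f g)\<^sup>2 \<partial>PM) = (\<integral>g. (f g)\<^sup>2 \<partial>PM) - (\<integral>g. (cavg i f g)\<^sup>2 \<partial>PM)"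
proof -
  note [simp] = L2_integrable_power2[OF assms(2)] L2_integrable_power2[OF L2_cavg[OF assms]]
    L2_integrable_mult[OF assms(2) L2_cavg[OF assms]]
  have "(\<integral>g. (f g - cavg i f g)\<^sup>2 \<partial>PM)
      = (\<integral>g. (f g)\<^sup>2 + (cavg i f g)\<^sup>2 - 2 * (f g * cavg i f g) \<partial>PM)"
    by (simp add: power2_diff mult.assoc)
  also have "\<dots> = (\<integral>g. (f g)\<^sup>2 \<partial>PM) + (\<integral>g. (cavg i f g)\<^sup>2 \<partial>PM) - 2 * (\<integral>g. f g * cavg i f g \<partial>PM)"
    by simp
  finally show ?thesis using integral_mult_cavg[OF assms] by simp
qed

text \<open>Jensen's inequality for the average itself, which has the same mean as
  \<open>f\<close>.\<close>

lemma integral_cavg_power2_le: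
  assumes "i \<in> I" "L2 f"
  shows "(\<integral>g. f g \<partial>PM)\<^sup>2 \<le> (\<integral>g. (cavg i f g)\<^sup>2 \<partial>PM)"
proof -
  have "0 \<le> PM.variance (cavg i f)" by (rule PM.variance_positive)
  also have "\<dots> = (\<integral>g. (cavg i f g)\<^sup>2 \<partial>PM) - (\<integral>g. cavg i f g \<partial>PM)\<^sup>2"
    using assms by (intro PM.variance_eq L2_integrable L2_integrable_power2 L2_cavg)
  finally show ?thesis
    using integral_cavg[OF assms(1) L2_integrable[OF assms(2)]] by simp
qed

text \<open>Given the coordinates other than \<open>i\<close>, the original and the resampled vector
  are independent with the same conditional law, so the expected product is the mean square of the
  conditional expectation.\<close>

lemma integral_mult_fun_upd:
  assumes "i \<in> I" "L2 f"
  shows "integrable (PM \<Otimes>\<^sub>M \<nu>) (\<lambda>(g, y). (f g)\<^sup>2)"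
    and "integrable (PM \<Otimes>\<^sub>M \<nu>) (\<lambda>(g, y). f g * f (g(i := y)))"
    and "(\<integral>(g, y). f g * f (g(i := y)) \<partial>(PM \<Otimes>\<^sub>M \<nu>)) = (\<integral>g. (cavg i f g)\<^sup>2 \<partial>PM)"
proof -
  let ?P = "PM \<Otimes>\<^sub>M \<nu>"
  note [measurable] = L2_measurable[OF assms(2)]
  have upd [measurable]: "(\<lambda>(g, y). f (g(i := y))) \<in> borel_measurable ?P"
    using integrable_fun_upd[OF assms(1) L2_integrable[OF assms(2)]] by simp
  have int_u: "integrable ?P (\<lambda>(g, y). (f (g(i := y)))\<^sup>2)"
    using integrable_fun_upd[OF assms(1) L2_integrable_power2[OF assms(2)]] .
  show int_f: "integrable ?P (\<lambda>(g, y). (f g)\<^sup>2)"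
    using integrable_distr[of fst ?P PM "\<lambda>g. (f g)\<^sup>2"] L2_integrable_power2[OF assms(2)]
    by (simp add: distr_pair_fst case_prod_unfold)
  show int_m: "integrable ?P (\<lambda>(g, y). f g * f (g(i := y)))"
  proof (rule Bochner_Integration.integrable_bound)
    show "integrable ?P (\<lambda>(g, y). (f g)\<^sup>2 + (f (g(i := y)))\<^sup>2)"
      using Bochner_Integration.integrable_add[OF int_f int_u] by (simp add: case_prod_unfold)
    show "(\<lambda>(g, y). f g * f (g(i := y))) \<in> borel_measurable ?P"
      using upd by (simp add: case_prod_unfold)
    show "AE x in ?P. norm (case x of (g, y) \<Rightarrow> f g * f (g(i := y))) \<le>
        norm (case x of (g, y) \<Rightarrow> (f g)\<^sup>2 + (f (g(i := y)))\<^sup>2)"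
      by (auto intro!: AE_I2 abs_mult_le_sum_squares)
  qed
  show "(\<integral>(g, y). f g * f (g(i := y)) \<partial>?P) = (\<integral>g. (cavg i f g)\<^sup>2 \<partial>PM)"
    using PM_pair.integral_fst'[OF int_m] integral_mult_cavg[OF assms]
    by (simp add: cavg_def)
qed

text \<open>After expanding the square, both pure squares have the same mean and the cross term is
  the squared norm of \<open>cavg i f\<close>; Pythagoras turns the result into twice the influence
  of \<open>i\<close>.\<close>

lemma integral_fun_upd_diff:
  assumes "i \<in> I" "L2 f"
  shows "integrable (PM \<Otimes>\<^sub>M \<nu>) (\<lambda>(g, y). (f g - f (g(i := y)))\<^sup>2)"
    and "(\<integral>(g, y). (f g - f (g(i := y)))\<^sup>2 \<partial>(PM \<Otimes>\<^sub>M \<nu>)) = 2 * (\<integral>g. (f g - cavg i f g)\<^sup>2 \<partial>PM)"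
proof -
  let ?P = "PM \<Otimes>\<^sub>M \<nu>"
  note [measurable] = L2_measurable[OF assms(2)]
  note int_f = integral_mult_fun_upd(1)[OF assms] and int_m = integral_mult_fun_upd(2)[OF assms]
  have f_eq: "(\<integral>(g, y). (f g)\<^sup>2 \<partial>?P) = (\<integral>g. (f g)\<^sup>2 \<partial>PM)"
    using integral_distr[of fst ?P PM "\<lambda>g. (f g)\<^sup>2"]
    by (simp add: distr_pair_fst case_prod_unfold)
  have int_u: "integrable ?P (\<lambda>(g, y). (f (g(i := y)))\<^sup>2)"
    using integrable_fun_upd[OF assms(1) L2_integrable_power2[OF assms(2)]] .
  have u_eq: "(\<integral>(g, y). (f (g(i := y)))\<^sup>2 \<partial>?P) = (\<integral>g. (f g)\<^sup>2 \<partial>PM)"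
    using integral_fun_upd[OF assms(1), of "\<lambda>g. (f g)\<^sup>2"] by simp
  have expand: "(\<lambda>(g, y). (f g - f (g(i := y)))\<^sup>2) =
      (\<lambda>x. (case x of (g, y) \<Rightarrow> (f g)\<^sup>2) + (case x of (g, y) \<Rightarrow> (f (g(i := y)))\<^sup>2)
         - 2 * (case x of (g, y) \<Rightarrow> f g * f (g(i := y))))"
    by (auto simp: fun_eq_iff power2_diff)
  show "integrable ?P (\<lambda>(g, y). (f g - f (g(i := y)))\<^sup>2)"
    unfolding expand using int_f int_u int_m by simp
  show "(\<integral>(g, y). (f g - f (g(i := y)))\<^sup>2 \<partial>?P) = 2 * (\<integral>g. (f g - cavg i f g)\<^sup>2 \<partial>PM)"
    unfolding expand
    using int_f int_u int_m f_eq u_eq integral_mult_fun_upd(3)[OF assms] integral_diff_cavg[OF assms]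
    by simp
qed

text \<open>For the indicator of \<open>B\<close>, the expected product over the resampled pair is
  the mean square of its conditional expectation, hence at least the square of its mean.\<close>

lemma measure_resample_pair:
  assumes "i \<in> I" "B \<in> sets PM"
  shows "(measure PM B)\<^sup>2 \<le> measure (PM \<Otimes>\<^sub>M \<nu>) {(g, y) \<in> space (PM \<Otimes>\<^sub>M \<nu>). g \<in> B \<and> g(i := y) \<in> B}"
proof -
  let ?P = "PM \<Otimes>\<^sub>M \<nu>" and ?f = "indicator B :: ('i \<Rightarrow> 'b) \<Rightarrow> real"
  let ?Q = "{(g, y) \<in> space ?P. g \<in> B \<and> g(i := y) \<in> B}"
  have f: "L2 ?f"
    using assms(2) by (auto simp: L2_def power2_eq_square indicator_times_eq_if intro!: PM.integrable_const_bound[of _ 1])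
  have Q: "?Q = (fst -` B \<inter> space ?P) \<inter> ((\<lambda>(g, y). g(i := y)) -` B \<inter> space ?P)" by auto
  have "?Q \<in> sets ?P"
    unfolding Q
    by (intro sets.Int measurable_sets[OF measurable_fst assms(2)]
        measurable_sets[OF fun_upd_measurable[OF assms(1)] assms(2)])
  have "(measure PM B)\<^sup>2 = (\<integral>g. ?f g \<partial>PM)\<^sup>2"
    using assms(2) by simp
  also have "\<dots> \<le> (\<integral>(g, y). ?f g * ?f (g(i := y)) \<partial>?P)"
    using integral_cavg_power2_le[OF assms(1) f] integral_mult_fun_upd(3)[OF assms(1) f] by simp
  also have "\<dots> = (\<integral>x. indicator ?Q x \<partial>?P)"
    by (intro Bochner_Integration.integral_cong) (auto simp: indicator_def)
  also have "\<dots> = measure ?P ?Q"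
    using \<open>?Q \<in> sets ?P\<close> by simp
  finally show ?thesis .
qed

text \<open>Conditioning on all coordinates but \<open>i\<close> reduces a probability bound to the
  randomness of one fresh value.\<close>

lemma measure_le_resample:
  assumes "i \<in> I" "B \<in> sets PM" "0 \<le> c"
    and "\<And>g. g \<in> space PM \<Longrightarrow> measure \<nu> {y \<in> space \<nu>. g(i := y) \<in> B} \<le> c"
  shows "measure PM B \<le> c"
proof -
  have Q: "(\<lambda>(g, y). g(i := y)) -` B \<inter> space (PM \<Otimes>\<^sub>M \<nu>) \<in> sets (PM \<Otimes>\<^sub>M \<nu>)"
    using measurable_sets[OF fun_upd_measurable[OF assms(1)] assms(2)] .
  have "measure PM B = measure (distr (PM \<Otimes>\<^sub>M \<nu>) PM (\<lambda>(g, y). g(i := y))) B"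
    by (simp add: distr_fun_upd[OF assms(1)])
  also have "\<dots> = measure (PM \<Otimes>\<^sub>M \<nu>) ((\<lambda>(g, y). g(i := y)) -` B \<inter> space (PM \<Otimes>\<^sub>M \<nu>))"
    by (rule measure_distr[OF fun_upd_measurable[OF assms(1)] assms(2)])
  also have "\<dots> \<le> c"
  proof (rule measure_pair_le[OF _ _ Q assms(3)])
    fix g assume g: "g \<in> space PM"
    then have "Pair g -` ((\<lambda>(g, y). g(i := y)) -` B \<inter> space (PM \<Otimes>\<^sub>M \<nu>)) = {y \<in> space \<nu>. g(i := y) \<in> B}"
      by (auto simp: space_pair_measure)
    then show "measure \<nu> (Pair g -` ((\<lambda>(g, y). g(i := y)) -` B \<inter> space (PM \<Otimes>\<^sub>M \<nu>))) \<le> c"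
      using assms(4)[OF g] by simp
  qed unfold_locales
  finally show ?thesis .
qed

text \<open>Fubini in the two fresh values, once the two-dimensional section through
  \<open>g\<close> is known to be integrable.\<close>

lemma cavg_commute:
  assumes "i \<in> I" "j \<in> I" "integrable PM f"
  shows "AE g in PM. cavg i (cavg j f) g = cavg j (cavg i f) g"
proof (cases "i = j")
  case False
  interpret \<nu>2: pair_sigma_finite \<nu> \<nu> ..
  have [measurable]: "f \<in> borel_measurable PM" using assms(3) by simp
  have abs: "integrable PM (\<lambda>g. \<bar>f g\<bar>)" using assms(3) by simp
  show ?thesis
    \<comment> \<open>These are the two requirements for integrability on the product: almost every
      inner section is integrable, and the integrated absolute values are integrable in the outer
      variable.\<close>
    using AE_fun_upd[OF assms(1) AE_section_integrable[OF assms(2,3)]]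
      AE_section_integrable[OF assms(1) integrable_cavg[OF assms(2) abs]] AE_space
  proof eventually_elim
    case (elim g)
    have "(\<lambda>y. g(i := y)) \<in> \<nu> \<rightarrow>\<^sub>M PM"
      using measurable_compose[OF measurable_Pair1'[OF elim(3)] fun_upd_measurable[OF assms(1)]] by simp
    then have "(\<lambda>(y, z). (g(i := y), z)) \<in> \<nu> \<Otimes>\<^sub>M \<nu> \<rightarrow>\<^sub>M PM \<Otimes>\<^sub>M \<nu>"
      by measurable
    from measurable_compose[OF measurable_compose[OF this fun_upd_measurable[OF assms(2)]], of f borel]
    have "(\<lambda>(y, z). f (g(i := y, j := z))) \<in> borel_measurable (\<nu> \<Otimes>\<^sub>M \<nu>)"
      by (simp add: case_prod_unfold)
    then have "integrable (\<nu> \<Otimes>\<^sub>M \<nu>) (\<lambda>(y, z). f (g(i := y, j := z)))"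
      using elim(1,2) by (intro \<nu>2.Fubini_integrable) (auto simp: cavg_def)
    from \<nu>2.Fubini_integral[of "\<lambda>y z. f (g(i := y, j := z))", OF this]
    show ?case using False by (simp add: cavg_def fun_upd_twist)
  qed
qed simp

text \<open>\<open>coord_deg T d\<close> measures the degree only in the coordinates of \<open>T\<close>, which makes an induction
  on \<open>T\<close> possible.  Independence of the coordinate \<open>i\<close> is expressed by invariance under \<open>cavg i\<close>.\<close>

inductive coord_deg :: "'i set \<Rightarrow> nat \<Rightarrow> (('i \<Rightarrow> 'b) \<Rightarrow> real) \<Rightarrow> bool" for T d where
  base: "L2 f \<Longrightarrow> card (J \<inter> T) \<le> d \<Longrightarrow> (\<And>i. i \<in> I - J \<Longrightarrow> AE g in PM. cavg i f g = f g) \<Longrightarrow>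
    coord_deg T d f"
| add: "coord_deg T d f \<Longrightarrow> coord_deg T d h \<Longrightarrow> coord_deg T d (\<lambda>g. f g + h g)"
| AE_cong: "coord_deg T d f \<Longrightarrow> h \<in> borel_measurable PM \<Longrightarrow> AE g in PM. f g = h g \<Longrightarrow> coord_deg T d h"

lemma coord_deg_L2: "coord_deg T d f \<Longrightarrow> L2 f"
proof (induction rule: coord_deg.induct)
  case (AE_cong f h)
  then show ?case by (intro L2_AE_cong[OF AE_cong(4)])
qed (auto intro: L2_add)

lemma coord_deg_zero: "coord_deg T d (\<lambda>_. 0)"
  by (rule coord_deg.base[where J = "{}"]) (auto simp: L2_const cavg_def)

text \<open>Since averages commute, a summand invariant under \<open>cavg i\<close> stays so after
  averaging over \<open>n\<close>; the same \<open>J\<close> serves, and dropping \<open>n\<close>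
  from the counted coordinates cannot raise the degree.\<close>

lemma coord_deg_cavg:
  assumes "coord_deg (insert n T) d f" "n \<in> I" "finite T"
  shows "coord_deg T d (cavg n f)"
  using assms(1)
proof (induction rule: coord_deg.induct)
  case (base f J)
  note n = assms(2) and f = L2_integrable[OF base(1)]
  show ?case
  proof (rule coord_deg.base)
    show "L2 (cavg n f)" using base n by (intro L2_cavg)
    have "card (J \<inter> T) \<le> card (J \<inter> insert n T)"
      using assms(3) by (intro card_mono) auto
    then show "card (J \<inter> T) \<le> d" using base(2) by simp
    fix i assume i: "i \<in> I - J"
    have "AE g in PM. cavg n (cavg i f) g = cavg n f g"
      using i n f by (intro cavg_AE_cong base(3)) auto
    moreover have "AE g in PM. cavg i (cavg n f) g = cavg n (cavg i f) g"
      using i n f by (intro cavg_commute) auto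
    ultimately show "AE g in PM. cavg i (cavg n f) g = cavg n f g"
      by eventually_elim simp
  qed
next
  case (add f h)
  note L2s = coord_deg_L2[OF add(1)] coord_deg_L2[OF add(2)]
  have "AE g in PM. cavg n f g + cavg n h g = cavg n (\<lambda>g. f g + h g) g"
    using cavg_add[OF assms(2) L2_integrable L2_integrable, OF L2s] by eventually_elim simp
  then show ?case
    by (intro coord_deg.AE_cong[OF coord_deg.add[OF add(3,4)]] cavg_measurable L2_measurable L2_add
        L2s assms(2))
next
  case (AE_cong f h)
  show ?case
    by (intro coord_deg.AE_cong[OF AE_cong(4)] cavg_measurable
        cavg_AE_cong[OF assms(2) L2_measurable[OF coord_deg_L2[OF AE_cong(1)]] AE_cong(2,3)] assms(2) AE_cong(2))
qed

text \<open>Subtracting the average kills the summands that do not depend on \<open>n\<close>. For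
  the others \<open>n\<close> is one of the counted coordinates, so removing it from the count
  lowers the degree by one.\<close>

lemma coord_deg_diff_cavg:
  assumes "coord_deg (insert n T) (Suc d) f" "n \<in> I" "finite T" "n \<notin> T"
  shows "coord_deg T d (\<lambda>g. f g - cavg n f g)"
  using assms(1)
proof (induction rule: coord_deg.induct)
  case (base f J)
  note n = assms(2) and f = L2_integrable[OF base(1)]
  have L2c: "L2 (cavg n f)" using base n by (intro L2_cavg)
  note [measurable] = L2_measurable[OF base(1)] L2_measurable[OF L2c]
  show ?case
  proof (cases "n \<in> J")
    case True
    show ?thesis
    proof (rule coord_deg.base)
      show "L2 (\<lambda>g. f g - cavg n f g)" using base L2c by (intro L2_diff)
      have "J \<inter> insert n T = insert n (J \<inter> T)" using True by auto
      then show "card (J \<inter> T) \<le> d" using base(2) assms(3,4) by simp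
      fix i assume i: "i \<in> I - J"
      have "AE g in PM. cavg n (cavg i f) g = cavg n f g"
        using i n f by (intro cavg_AE_cong base(3)) auto
      moreover have "AE g in PM. cavg i (cavg n f) g = cavg n (cavg i f) g"
        using i n f by (intro cavg_commute) auto
      moreover have "AE g in PM. cavg i (\<lambda>g. f g - cavg n f g) g = cavg i f g - cavg i (cavg n f) g"
        using i f L2_integrable[OF L2c] by (intro cavg_diff) auto
      ultimately show "AE g in PM. cavg i (\<lambda>g. f g - cavg n f g) g = f g - cavg n f g"
        using base(3)[OF i] by eventually_elim simp
    qed
  next
    case False
    with base(3)[of n] n have "AE g in PM. 0 = f g - cavg n f g" by auto
    then show ?thesis
      by (intro coord_deg.AE_cong[OF coord_deg_zero]) auto
  qed
next
  case (add f h)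
  note L2s = coord_deg_L2[OF add(1)] coord_deg_L2[OF add(2)]
  note meas = L2_measurable[OF L2s(1)] L2_measurable[OF L2s(2)]
  have "AE g in PM. f g - cavg n f g + (h g - cavg n h g) = f g + h g - cavg n (\<lambda>g. f g + h g) g"
    using cavg_add[OF assms(2) L2_integrable L2_integrable, OF L2s] by eventually_elim simp
  then show ?case
    using meas assms(2)
    by (intro coord_deg.AE_cong[OF coord_deg.add[OF add(3,4)]] borel_measurable_diff
        cavg_measurable borel_measurable_add) auto
next
  case (AE_cong f h)
  note meas = L2_measurable[OF coord_deg_L2[OF AE_cong(1)]]
  have "AE g in PM. f g - cavg n f g = h g - cavg n h g"
    using cavg_AE_cong[OF assms(2) meas AE_cong(2,3)] AE_cong(3) by eventually_elim simp
  then show ?case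
    using AE_cong(2) assms(2)
    by (intro coord_deg.AE_cong[OF AE_cong(4)] borel_measurable_diff cavg_measurable) auto
qed

text \<open>Degree 0 forces \<open>J\<close> to miss the finite set \<open>insert n T\<close>, so no
  summand depends on \<open>n\<close>.\<close>

lemma coord_deg_0_cavg:
  assumes "coord_deg (insert n T) 0 f" "n \<in> I" "finite T"
  shows "AE g in PM. cavg n f g = f g"
  using assms(1)
proof (induction rule: coord_deg.induct)
  case (base f J)
  then have "n \<notin> J" using assms(3) by auto
  then show ?case using base(3) assms(2) by simp
next
  case (add f h)
  note L2s = coord_deg_L2[OF add(1)] coord_deg_L2[OF add(2)]
  show ?case
    using cavg_add[OF assms(2) L2_integrable L2_integrable, OF L2s] add(3,4) by eventually_elim simp
next
  case (AE_cong f h)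
  note meas = L2_measurable[OF coord_deg_L2[OF AE_cong(1)]]
  show ?case
    using cavg_AE_cong[OF assms(2) meas AE_cong(2,3)] AE_cong(3,4) by eventually_elim simp
qed

text \<open>The splitting of \<open>f\<close> into \<open>cavg n f\<close> and \<open>f - cavg n f\<close> is orthogonal and commutes with the other
  averages; the second summand has lost one degree in the remaining coordinates.\<close>

theorem total_influence_le:
  assumes "finite T" "T \<subseteq> I" "coord_deg T d f"
  shows "(\<Sum>i\<in>T. \<integral>g. (f g - cavg i f g)\<^sup>2 \<partial>PM) \<le> real d * (\<integral>g. (f g)\<^sup>2 \<partial>PM)"
  using assms
proof (induction T arbitrary: f d rule: finite_induct)
  case empty
  then show ?case by simp
next
  case (insert n T)
  have n: "n \<in> I" and T: "T \<subseteq> I" using insert.prems by auto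
  define a where "a = cavg n f"
  define b where "b = (\<lambda>g. f g - cavg n f g)"
  have f: "L2 f" using insert.prems coord_deg_L2 by blast
  have a: "L2 a" unfolding a_def using f n by (intro L2_cavg)
  have b: "L2 b" unfolding b_def using f a by (intro L2_diff) (auto simp: a_def)
  \<comment> \<open>Pythagoras in direction \<open>n\<close> for \<open>h = f - cavg i f\<close>. As
    the averages commute, the two components of \<open>h\<close> are the same differences formed
    from \<open>a\<close> and \<open>b\<close>.\<close>
  have split: "(\<integral>g. (f g - cavg i f g)\<^sup>2 \<partial>PM) =
      (\<integral>g. (a g - cavg i a g)\<^sup>2 \<partial>PM) + (\<integral>g. (b g - cavg i b g)\<^sup>2 \<partial>PM)" if "i \<in> T" for i
  proof -
    have i: "i \<in> I" using that T by auto
    define h where "h = (\<lambda>g. f g - cavg i f g)"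
    have ci: "L2 (cavg i f)" using f i by (intro L2_cavg)
    have h: "L2 h" unfolding h_def using f ci by (intro L2_diff)
    have ch: "L2 (cavg n h)" using h n by (intro L2_cavg)
    have hn: "AE g in PM. cavg n h g = a g - cavg i a g"
      unfolding h_def a_def
      using cavg_diff[OF n L2_integrable[OF f] L2_integrable[OF ci]]
        cavg_commute[OF i n L2_integrable[OF f]]
      by eventually_elim simp
    have "AE g in PM. h g - cavg n h g = b g - cavg i b g"
      using hn cavg_diff[OF i L2_integrable[OF f] L2_integrable[OF a]]
      by eventually_elim (simp add: h_def b_def a_def)
    then have bn: "AE g in PM. (h g - cavg n h g)\<^sup>2 = (b g - cavg i b g)\<^sup>2"
      by eventually_elim simp
    note meas = borel_measurable_power L2_measurable L2_diff L2_cavg h b a n i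
    have "(\<integral>g. (h g - cavg n h g)\<^sup>2 \<partial>PM) = (\<integral>g. (b g - cavg i b g)\<^sup>2 \<partial>PM)"
      by (rule integral_cong_AE[OF _ _ bn]) (intro meas)+
    moreover have "AE g in PM. (cavg n h g)\<^sup>2 = (a g - cavg i a g)\<^sup>2"
      using hn by eventually_elim simp
    then have "(\<integral>g. (cavg n h g)\<^sup>2 \<partial>PM) = (\<integral>g. (a g - cavg i a g)\<^sup>2 \<partial>PM)"
      by (rule integral_cong_AE[rotated 2]) (intro meas)+
    ultimately show ?thesis using integral_diff_cavg[OF n h] by (simp add: h_def)
  qed
  have norm: "(\<integral>g. (b g)\<^sup>2 \<partial>PM) = (\<integral>g. (f g)\<^sup>2 \<partial>PM) - (\<integral>g. (a g)\<^sup>2 \<partial>PM)"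
    unfolding a_def b_def by (rule integral_diff_cavg[OF n f])
  have IHa: "(\<Sum>i\<in>T. \<integral>g. (a g - cavg i a g)\<^sup>2 \<partial>PM) \<le> real d * (\<integral>g. (a g)\<^sup>2 \<partial>PM)"
    using coord_deg_cavg[OF insert.prems(2) n insert.hyps(1)] by (intro insert.IH T) (simp add: a_def)
  \<comment> \<open>The additional squared norm of \<open>b\<close> is the influence of
    \<open>n\<close> itself; it is paid for by the degree that \<open>b\<close> has lost. In degree
    0 there is none to lose, but then \<open>b\<close> vanishes almost everywhere.\<close>
  have IHb: "(\<Sum>i\<in>T. \<integral>g. (b g - cavg i b g)\<^sup>2 \<partial>PM) + (\<integral>g. (b g)\<^sup>2 \<partial>PM) \<le> real d * (\<integral>g. (b g)\<^sup>2 \<partial>PM)"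
  proof (cases d)
    case 0
    have b0: "AE g in PM. b g = 0"
      using coord_deg_0_cavg[OF insert.prems(2)[unfolded 0] n insert.hyps(1)]
      by eventually_elim (simp add: b_def)
    then have "AE g in PM. (b g)\<^sup>2 = 0"
      by eventually_elim simp
    then have "(\<integral>g. (b g)\<^sup>2 \<partial>PM) = 0"
      by (rule integral_eq_zero_AE)
    moreover have "coord_deg T 0 b"
      using b0 L2_measurable[OF b] by (intro coord_deg.AE_cong[OF coord_deg_zero]) auto
    then have "(\<Sum>i\<in>T. \<integral>g. (b g - cavg i b g)\<^sup>2 \<partial>PM) \<le> real 0 * (\<integral>g. (b g)\<^sup>2 \<partial>PM)"
      by (intro insert.IH T)
    ultimately show ?thesis using 0 by simp
  next
    case (Suc d')
    have "coord_deg T d' b"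
      unfolding b_def using coord_deg_diff_cavg insert.prems(2) n insert.hyps Suc by blast
    from insert.IH[OF T this] show ?thesis by (simp add: Suc algebra_simps)
  qed
  have "(\<Sum>i\<in>insert n T. \<integral>g. (f g - cavg i f g)\<^sup>2 \<partial>PM)
      = (\<integral>g. (b g)\<^sup>2 \<partial>PM) + (\<Sum>i\<in>T. \<integral>g. (a g - cavg i a g)\<^sup>2 \<partial>PM)
        + (\<Sum>i\<in>T. \<integral>g. (b g - cavg i b g)\<^sup>2 \<partial>PM)"
    using insert.hyps split by (simp add: sum.distrib b_def)
  also have "\<dots> \<le> real d * (\<integral>g. (a g)\<^sup>2 \<partial>PM) + real d * (\<integral>g. (b g)\<^sup>2 \<partial>PM)"
    using IHa IHb by simp
  also have "\<dots> = real d * (\<integral>g. (f g)\<^sup>2 \<partial>PM)"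
    by (simp add: norm algebra_simps)
  finally show ?case .
qed

end
section \<open>Randomized rounding\<close>

declare One_nat_def [simp del]

section \<open>The Gaussian vector and the stability of the algorithm under resampling\<close>

abbreviation std_normal :: "real measure" where
  "std_normal \<equiv> density lborel (\<lambda>x. ennreal (std_normal_density x))"

lemma iid_product_std_normal: "iid_product std_normal {1..N::nat}"
  by (intro iid_product.intro prob_space_normal_density) (auto simp: iid_product_axioms_def)

interpretation G: iid_product std_normal "{1..N}" for N :: nat
  by (rule iid_product_std_normal)

text \<open>Averaging over a coordinate outside \<open>J\<close> fixes the function of the
  coordinates in \<open>J\<close> pointwise; the representative \<open>f\<close> inherits this up to
  a null set.\<close>

lemma V_coord_coord_deg:
  assumes "f \<in> V_coord N J" "J \<subseteq> {1..N}" "card J \<le> D"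
  shows "G.coord_deg N {1..N} D f"
proof (rule G.coord_deg.base)
  from assms(1) obtain h where f: "f \<in> borel_measurable (gauss N)" "integrable (gauss N) (\<lambda>g. (f g)\<^sup>2)"
    and h: "h \<in> borel_measurable (\<Pi>\<^sub>M i\<in>J. borel)" and fh: "AE g in gauss N. f g = h (restrict g J)"
    by (auto simp: V_coord_def)
  show L2: "G.L2 N f" using f by (simp add: G.L2_def gauss_def)
  show "card (J \<inter> {1..N}) \<le> D" using assms(2,3) by (simp add: Int_absorb2)
  fix i assume i: "i \<in> {1..N} - J"
  define u where "u = (\<lambda>g :: nat \<Rightarrow> real. h (restrict g J))"
  have "sets (\<Pi>\<^sub>M i\<in>J. borel) = sets (\<Pi>\<^sub>M i\<in>J. std_normal)"
    by (intro sets_PiM_cong) auto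
  with h have "h \<in> borel_measurable (\<Pi>\<^sub>M i\<in>J. std_normal)"
    by (subst measurable_cong_sets[OF _ refl]) auto
  then have u: "u \<in> borel_measurable (G.PM N)"
    unfolding u_def by (rule measurable_compose[OF measurable_restrict_subset[OF assms(2)]])
  have fu: "AE g in G.PM N. f g = u g"
    using fh unfolding u_def gauss_def .
  have "u (g(i := y)) = u g" for g y
    using i by (auto simp: u_def intro!: arg_cong[where f = h])
  then have [simp]: "G.cavg i u g = u g" for g
    using G.prob_space
    by (simp add: G.cavg_def)
  show "AE g in G.PM N. G.cavg i f g = f g"
    using G.cavg_AE_cong[OF DiffD1[OF i] G.L2_measurable[OF L2] u fu] fu by eventually_elim simp
qed

text \<open>\<open>coord_deg\<close> has rules for sums but not for scalars; in a linear combination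
  the scalars are absorbed by the generators.\<close>

lemma V_coord_scale:
  assumes "f \<in> V_coord N J"
  shows "(\<lambda>g. c * f g) \<in> V_coord N J"
proof -
  from assms obtain h where h: "h \<in> borel_measurable (\<Pi>\<^sub>M i\<in>J. borel)"
    and fh: "AE g in gauss N. f g = h (restrict g J)"
    by (auto simp: V_coord_def)
  have "AE g in gauss N. c * f g = c * h (restrict g J)"
    using fh by eventually_elim simp
  then have "\<exists>h'\<in>borel_measurable (\<Pi>\<^sub>M i\<in>J. borel). AE g in gauss N. c * f g = h' (restrict g J)"
    using h by (intro bexI[of _ "\<lambda>x. c * h x"]) auto
  then show ?thesis
    using assms by (auto simp: V_coord_def power_mult_distrib)
qed

lemma V_le_coord_deg:
  assumes "f \<in> V_le N D"
  shows "G.coord_deg N {1..N} D f"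
proof -
  interpret vs: vector_space "\<lambda>(c::real) (f :: (nat \<Rightarrow> real) \<Rightarrow> real) g. c * f g"
    by (rule vector_space_pointwise)
  show ?thesis
    using assms unfolding V_le_def
  proof (induction rule: vs.span_induct_alt)
    case base
    show ?case using G.coord_deg_zero by (simp add: zero_fun_def)
  next
    case (step c x y)
    then obtain J where "J \<subseteq> {1..N}" "card J \<le> D" "x \<in> V_coord N J" by auto
    then have "G.coord_deg N {1..N} D (\<lambda>g. c * x g)"
      by (intro V_coord_coord_deg V_coord_scale)
    from G.coord_deg.add[OF this step(2)] show ?case by (simp add: plus_fun_def)
  qed
qed

lemma coord_degree_algorithm_component:
  assumes "coord_degree_algorithm N D A" "j \<in> {1..N}"
  shows "G.L2 N (\<lambda>g. A g j)" "G.coord_deg N {1..N} D (\<lambda>g. A g j)"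
proof -
  show deg: "G.coord_deg N {1..N} D (\<lambda>g. A g j)"
    using assms by (intro V_le_coord_deg) (auto simp: coord_degree_algorithm_def)
  show "G.L2 N (\<lambda>g. A g j)" by (rule G.coord_deg_L2[OF deg])
qed

text \<open>The total influence bound for each component, summed over the components. The factor 2
  is that of \<open>integral_fun_upd_diff\<close>.\<close>

lemma sum_resample_stability:
  assumes "coord_degree_algorithm N D A"
  shows "\<And>i. i \<in> {1..N} \<Longrightarrow> integrable (G.PM N \<Otimes>\<^sub>M std_normal) (\<lambda>(g, y). \<Sum>j=1..N. (A g j - A (g(i := y)) j)\<^sup>2)"
    and "(\<Sum>i=1..N. \<integral>(g, y). (\<Sum>j=1..N. (A g j - A (g(i := y)) j)\<^sup>2) \<partial>(G.PM N \<Otimes>\<^sub>M std_normal))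
      \<le> 2 * real D * (\<integral>g. (L2_set (A g) {1..N})\<^sup>2 \<partial>gauss N)"
proof -
  note comp = coord_degree_algorithm_component[OF assms]
  let ?P = "G.PM N \<Otimes>\<^sub>M std_normal"
  have int: "integrable ?P (\<lambda>x. case x of (g, y) \<Rightarrow> (A g j - A (g(i := y)) j)\<^sup>2)"
    if "i \<in> {1..N}" "j \<in> {1..N}" for i j
    using G.integral_fun_upd_diff(1)[OF that(1) comp(1)[OF that(2)]] .
  have sum_eq: "(\<lambda>(g, y). \<Sum>j=1..N. (A g j - A (g(i := y)) j)\<^sup>2) =
      (\<lambda>x. \<Sum>j=1..N. case x of (g, y) \<Rightarrow> (A g j - A (g(i := y)) j)\<^sup>2)" for i
    by (auto simp: fun_eq_iff)
  show "integrable ?P (\<lambda>(g, y). \<Sum>j=1..N. (A g j - A (g(i := y)) j)\<^sup>2)" if "i \<in> {1..N}" for i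
    unfolding sum_eq using int that by (intro Bochner_Integration.integrable_sum) auto
  have "(\<Sum>i=1..N. \<integral>(g, y). (\<Sum>j=1..N. (A g j - A (g(i := y)) j)\<^sup>2) \<partial>?P)
      = (\<Sum>i=1..N. \<Sum>j=1..N. \<integral>(g, y). (A g j - A (g(i := y)) j)\<^sup>2 \<partial>?P)"
    unfolding sum_eq using int by (intro sum.cong refl Bochner_Integration.integral_sum) auto
  also have "\<dots> = (\<Sum>i=1..N. \<Sum>j=1..N. 2 * (\<integral>g. (A g j - G.cavg i (\<lambda>g. A g j) g)\<^sup>2 \<partial>G.PM N))"
    by (intro sum.cong refl G.integral_fun_upd_diff(2) comp(1))
  also have "\<dots> = 2 * (\<Sum>j=1..N. \<Sum>i=1..N. \<integral>g. (A g j - G.cavg i (\<lambda>g. A g j) g)\<^sup>2 \<partial>G.PM N)"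
    by (subst sum.swap) (simp add: sum_distrib_left)
  also have "\<dots> \<le> 2 * (\<Sum>j=1..N. real D * (\<integral>g. (A g j)\<^sup>2 \<partial>G.PM N))"
    by (intro mult_left_mono sum_mono G.total_influence_le comp(2)) auto
  also have "\<dots> = 2 * real D * (\<Sum>j=1..N. \<integral>g. (A g j)\<^sup>2 \<partial>G.PM N)"
    by (simp add: sum_distrib_left mult.assoc)
  also have "(\<Sum>j=1..N. \<integral>g. (A g j)\<^sup>2 \<partial>G.PM N) = (\<integral>g. (\<Sum>j=1..N. (A g j)\<^sup>2) \<partial>G.PM N)"
    by (intro Bochner_Integration.integral_sum[symmetric] G.L2_integrable_power2 comp(1))
  also have "\<dots> = (\<integral>g. (L2_set (A g) {1..N})\<^sup>2 \<partial>gauss N)"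
    by (simp add: L2_set_def sum_nonneg gauss_def)
  finally show "(\<Sum>i=1..N. \<integral>(g, y). (\<Sum>j=1..N. (A g j - A (g(i := y)) j)\<^sup>2) \<partial>?P)
      \<le> 2 * real D * (\<integral>g. (L2_set (A g) {1..N})\<^sup>2 \<partial>gauss N)" .
qed

text \<open>As \<open>c\<close> is a sign, the set is an interval of length \<open>2 * e\<close>,
  and the density is at most 1/2 because \<open>2 * pi\<close> exceeds 4.\<close>

lemma std_normal_small_ball:
  assumes "e \<ge> 0" "\<bar>c\<bar> = 1"
  shows "measure std_normal {y. \<bar>b + y * c\<bar> \<le> e} \<le> e"
proof -
  have set_eq: "{y. \<bar>b + y * c\<bar> \<le> e} = {- b * c - e..- b * c + e}"
    using assms(2) by (auto simp: abs_if split: if_splits)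
  have density: "std_normal_density x \<le> 1 / 2" for x
  proof -
    have "2 \<le> sqrt (2 * pi)"
      using pi_gt3 by (intro real_le_rsqrt) simp
    moreover have "exp (- x\<^sup>2 / 2) \<le> 1" by simp
    ultimately show ?thesis
      unfolding std_normal_density_def
      using mult_mono[of "1 / sqrt (2 * pi)" "1/2" "exp (- x\<^sup>2 / 2)" 1] by (simp add: field_simps)
  qed
  have "emeasure std_normal {- b * c - e..- b * c + e}
      = (\<integral>\<^sup>+x. ennreal (std_normal_density x) * indicator {- b * c - e..- b * c + e} x \<partial>lborel)"
    by (subst emeasure_density) auto
  also have "\<dots> \<le> (\<integral>\<^sup>+x. ennreal (1 / 2) * indicator {- b * c - e..- b * c + e} x \<partial>lborel)"
    by (intro nn_integral_mono mult_right_mono ennreal_leI density) auto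
  also have "\<dots> = ennreal (1 / 2) * ennreal (2 * e)"
    using assms(1) by (subst nn_integral_cmult_indicator) auto
  also have "\<dots> = ennreal e"
    using assms(1) by (subst ennreal_mult[symmetric]) auto
  finally show ?thesis
    unfolding set_eq measure_def using assms(1) by (intro enn2real_leI)
qed

section \<open>Sign probabilities of one rounded coordinate\<close>

definition flip_prob :: "real \<Rightarrow> real" where
  "flip_prob a = max 0 ((1 - \<bar>a\<bar>) / 2)"

definition sign_prob :: "real \<Rightarrow> real \<Rightarrow> real" where
  "sign_prob a \<sigma> = measure (uniform_measure lborel {-1..1}) {u. rsign (a - u) = \<sigma>}"

lemma rsign_eq_sets [measurable]: "{u. rsign (a - u) = \<sigma>} \<in> sets borel"
  unfolding rsign_def by measurable

lemma sign_prob_eq: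
  "sign_prob a 1 = max 0 (min 1 ((1 + a) / 2))" "sign_prob a (-1) = max 0 (min 1 ((1 - a) / 2))"
proof -
  have l: "measure lborel ({-1..1} \<inter> {..<a}) = max 0 (min 2 (1 + a))"
  proof -
    consider "a \<le> -1" | "-1 < a" "a \<le> 1" | "1 < a" by linarith
    then show ?thesis
    proof cases
      case 1
      then have "{-1..1} \<inter> {..<a} = {}" by auto
      then show ?thesis using 1 by simp
    next
      case 2
      then have "{-1..1} \<inter> {..<a} = {-1..<a}" by auto
      then show ?thesis using 2 by simp
    next
      case 3
      then have "{-1..1} \<inter> {..<a} = {-1..1}" by auto
      then show ?thesis using 3 by simp
    qed
  qed
  have g: "measure lborel ({-1..1} \<inter> {a..}) = max 0 (min 2 (1 - a))"
  proof -
    consider "a \<le> -1" | "-1 < a" "a \<le> 1" | "1 < a" by linarith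
    then show ?thesis
    proof cases
      case 1
      then have "{-1..1} \<inter> {a..} = {-1..1}" by auto
      then show ?thesis using 1 by simp
    next
      case 2
      then have "{-1..1} \<inter> {a..} = {a..1}" by auto
      then show ?thesis using 2 by simp
    next
      case 3
      then have "{-1..1} \<inter> {a..} = {}" by auto
      then show ?thesis using 3 by simp
    qed
  qed
  have "{u. rsign (a - u) = 1} = {..<a}" "{u. rsign (a - u) = -1} = {a..}"
    by (auto simp: rsign_def split: if_splits)
  then show "sign_prob a 1 = max 0 (min 1 ((1 + a) / 2))" "sign_prob a (-1) = max 0 (min 1 ((1 - a) / 2))"
    using l g by (auto simp: sign_prob_def max_def min_def)
qed

lemma flip_prob_nonneg: "0 \<le> flip_prob a"
  by (simp add: flip_prob_def)

text \<open>\<open>flip_prob a\<close> is the probability of the less likely of the two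
  signs.\<close>

lemma flip_prob_le_sign_prob: "\<sigma> \<in> {-1, 1} \<Longrightarrow> flip_prob a \<le> sign_prob a \<sigma>"
  by (auto simp: flip_prob_def sign_prob_eq max_def min_def abs_if)

text \<open>This is the meaning of \<open>flip_prob\<close>: the chance that rounding disagrees with
  the sign. It is 0 once \<open>a\<close> leaves the interval from -1 to 1, where rounding is
  deterministic.\<close>

lemma sign_prob_uminus_rsign: "sign_prob a (- rsign a) = flip_prob a"
  by (auto simp: flip_prob_def sign_prob_eq rsign_def)

lemma sign_prob_bounds: "0 \<le> sign_prob a \<sigma>" "sign_prob a \<sigma> \<le> 1"
proof -
  interpret U: prob_space "uniform_measure lborel {-1..1::real}"
    by (rule prob_space_uniform_measure) auto
  show "0 \<le> sign_prob a \<sigma>" "sign_prob a \<sigma> \<le> 1"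
    unfolding sign_prob_def by (rule measure_nonneg, rule U.prob_le_1)
qed

section \<open>The law of the rounded vector, conditionally on the output \<open>a\<close> of the
  algorithm\<close>

definition round_vec :: "nat \<Rightarrow> (nat \<Rightarrow> real) \<Rightarrow> (nat \<Rightarrow> real) \<Rightarrow> (nat \<Rightarrow> real)" where
  "round_vec N a u = (\<lambda>i\<in>{1..N}. rsign (a i - u i))"

interpretation U: iid_product "uniform_measure lborel {-1..1::real}" "{1..N}" for N :: nat
  by (intro iid_product.intro prob_space_uniform_measure) (auto simp: iid_product_axioms_def)

lemma unif_cube_eq: "unif_cube N = U.PM N"
  by (simp add: unif_cube_def)

lemma round_vec_cube: "round_vec N a u \<in> Sigma_cube N"
  by (auto simp: round_vec_def Sigma_cube_def rsign_def)

lemma finite_Sigma_cube [simp]: "finite (Sigma_cube N)"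
  by (auto simp: Sigma_cube_def intro!: finite_PiE)

lemma round_vec_eq_iff:
  assumes "x \<in> Sigma_cube N"
  shows "round_vec N a u = x \<longleftrightarrow> (\<forall>i\<in>{1..N}. rsign (a i - u i) = x i)"
  using assms by (auto simp: round_vec_def Sigma_cube_def fun_eq_iff PiE_iff extensional_def)

lemma round_vec_fibre:
  assumes "x \<in> Sigma_cube N"
  shows "{u \<in> space (unif_cube N). round_vec N a u = x} = (\<Pi>\<^sub>E i\<in>{1..N}. {u. rsign (a i - u) = x i})"
  using round_vec_eq_iff[OF assms] by (auto simp: unif_cube_def space_PiM PiE_iff extensional_def)

lemma round_vec_fibre_sets:
  assumes "x \<in> Sigma_cube N"
  shows "{u \<in> space (unif_cube N). round_vec N a u = x} \<in> sets (unif_cube N)"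
  by (subst round_vec_fibre[OF assms]) (auto simp: unif_cube_def intro!: sets_PiM_I_finite)

lemma measure_round_vec_eq:
  assumes "x \<in> Sigma_cube N"
  shows "measure (unif_cube N) {u \<in> space (unif_cube N). round_vec N a u = x} = (\<Prod>i=1..N. sign_prob (a i) (x i))"
proof -
  interpret finite_product_prob_space "\<lambda>_. uniform_measure lborel {-1..1::real}" "{1..N}"
    by standard auto
  show ?thesis
    unfolding round_vec_fibre[OF assms] sign_prob_def
    by (simp add: unif_cube_def finite_measure_PiM_emb)
qed

lemma measure_round_vec_mem:
  assumes "S \<subseteq> Sigma_cube N"
  shows "{u \<in> space (unif_cube N). round_vec N a u \<in> S} \<in> sets (unif_cube N)"
    and "measure (unif_cube N) {u \<in> space (unif_cube N). round_vec N a u \<in> S} =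
      (\<Sum>x\<in>S. \<Prod>i=1..N. sign_prob (a i) (x i))"
proof -
  interpret prob_space "unif_cube N"
    unfolding unif_cube_eq by (rule U.PM.prob_space_axioms)
  have fin: "finite S" using assms finite_subset finite_Sigma_cube by blast
  have eq: "{u \<in> space (unif_cube N). round_vec N a u \<in> S} =
      (\<Union>x\<in>S. {u \<in> space (unif_cube N). round_vec N a u = x})" by auto
  have sets: "{u \<in> space (unif_cube N). round_vec N a u = x} \<in> sets (unif_cube N)" if "x \<in> S" for x
    using assms that by (intro round_vec_fibre_sets) auto
  show "{u \<in> space (unif_cube N). round_vec N a u \<in> S} \<in> sets (unif_cube N)"
    unfolding eq using fin sets by (intro sets.finite_UN) auto
  have "measure (unif_cube N) {u \<in> space (unif_cube N). round_vec N a u \<in> S}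
      = (\<Sum>x\<in>S. measure (unif_cube N) {u \<in> space (unif_cube N). round_vec N a u = x})"
    unfolding eq using fin sets
    by (intro finite_measure_finite_Union) (auto simp: disjoint_family_on_def)
  also have "\<dots> = (\<Sum>x\<in>S. \<Prod>i=1..N. sign_prob (a i) (x i))"
    using assms by (intro sum.cong refl measure_round_vec_eq) auto
  finally show "measure (unif_cube N) {u \<in> space (unif_cube N). round_vec N a u \<in> S} =
      (\<Sum>x\<in>S. \<Prod>i=1..N. sign_prob (a i) (x i))" .
qed

definition flip :: "nat \<Rightarrow> (nat \<Rightarrow> real) \<Rightarrow> nat \<Rightarrow> real" where
  "flip i x = x(i := - x i)"

lemma flip_cube: "x \<in> Sigma_cube N \<Longrightarrow> i \<in> {1..N} \<Longrightarrow> flip i x \<in> Sigma_cube N"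
  by (auto simp: flip_def Sigma_cube_def PiE_iff extensional_def)

lemma flip_flip [simp]: "flip i (flip i x) = x"
  by (simp add: flip_def)

text \<open>If no two elements of \<open>S\<close> differ in exactly two coordinates, the neighbours \<open>flip i x\<close> of
  the points \<open>x\<close> of \<open>S\<close> are pairwise distinct, and \<open>flip i x\<close> has at least \<open>flip_prob (a i)\<close> times the mass
  of \<open>x\<close>.\<close>

lemma round_vec_separated:
  assumes S: "S \<subseteq> Sigma_cube N"
    and sep: "\<And>x i j. x \<in> S \<Longrightarrow> i \<in> {1..N} \<Longrightarrow> j \<in> {1..N} \<Longrightarrow> i \<noteq> j \<Longrightarrow> flip j (flip i x) \<notin> S"
  shows "measure (unif_cube N) {u \<in> space (unif_cube N). round_vec N a u \<in> S} * (\<Sum>i=1..N. flip_prob (a i)) \<le> 1"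
proof -
  interpret prob_space "unif_cube N"
    unfolding unif_cube_eq by (rule U.PM.prob_space_axioms)
  define \<mu> where "\<mu> x = (\<Prod>i=1..N. sign_prob (a i) (x i))" for x :: "nat \<Rightarrow> real"
  have \<mu>_nonneg: "0 \<le> \<mu> x" for x
    by (auto simp: \<mu>_def intro!: prod_nonneg sign_prob_bounds)
  \<comment> \<open>Only factor \<open>i\<close> of the product changes: the old one is at most 1,
    the new one at least \<open>flip_prob (a i)\<close>.\<close>
  have flip_mass: "\<mu> x * flip_prob (a i) \<le> \<mu> (flip i x)" if x: "x \<in> S" and i: "i \<in> {1..N}" for x i
  proof -
    define r where "r = (\<Prod>j\<in>{1..N} - {i}. sign_prob (a j) (x j))"
    have r: "0 \<le> r" by (auto simp: r_def intro!: prod_nonneg sign_prob_bounds)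
    have "\<mu> x = sign_prob (a i) (x i) * r"
      unfolding \<mu>_def r_def using i by (intro prod.remove) auto
    moreover have "\<mu> (flip i x) = sign_prob (a i) (- x i) * r"
      unfolding \<mu>_def r_def using i by (subst prod.remove[of _ i]) (auto simp: flip_def intro!: prod.cong)
    moreover have "- x i \<in> {-1, 1}"
      using x i S PiE_mem[of x "{1..N}" "\<lambda>_. {-1, 1}" i] by (auto simp: Sigma_cube_def)
    then have "sign_prob (a i) (x i) * flip_prob (a i) \<le> 1 * sign_prob (a i) (- x i)"
      by (intro mult_mono flip_prob_le_sign_prob sign_prob_bounds flip_prob_nonneg) auto
    then have "sign_prob (a i) (x i) * flip_prob (a i) * r \<le> 1 * sign_prob (a i) (- x i) * r"
      by (rule mult_right_mono[OF _ r])
    ultimately show ?thesis by (simp add: mult_ac)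
  qed
  \<comment> \<open>If two pairs with different indices had the same image, \<open>y\<close> would
    be \<open>x\<close> flipped in two coordinates, against the separation.\<close>
  have inj: "inj_on (\<lambda>(x, i). flip i x) (S \<times> {1..N})"
  proof (rule inj_onI, clarify)
    fix x i y j
    assume *: "x \<in> S" "y \<in> S" "i \<in> {1..N}" "j \<in> {1..N}" "flip i x = flip j y"
    then have "flip j (flip i x) = y" by simp
    with sep[of x i j] * have "i = j" by auto
    with * show "x = y \<and> i = j" by (metis flip_flip)
  qed
  have fin: "finite S" using S finite_subset finite_Sigma_cube by blast
  have "measure (unif_cube N) {u \<in> space (unif_cube N). round_vec N a u \<in> S} * (\<Sum>i=1..N. flip_prob (a i))
      = (\<Sum>x\<in>S. \<Sum>i=1..N. \<mu> x * flip_prob (a i))"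
    using measure_round_vec_mem(2)[OF S] by (simp add: \<mu>_def sum_product)
  also have "\<dots> \<le> (\<Sum>x\<in>S. \<Sum>i=1..N. \<mu> (flip i x))"
    by (intro sum_mono flip_mass) auto
  also have "\<dots> = (\<Sum>p\<in>S \<times> {1..N}. \<mu> ((\<lambda>(x, i). flip i x) p))"
    by (subst sum.cartesian_product) (simp add: case_prod_unfold)
  also have "\<dots> = (\<Sum>x\<in>(\<lambda>(x, i). flip i x) ` (S \<times> {1..N}). \<mu> x)"
    by (subst sum.reindex[OF inj]) simp
  \<comment> \<open>The neighbours are distinct points of the cube, so their masses add up to at
    most 1.\<close>
  also have "\<dots> \<le> (\<Sum>x\<in>Sigma_cube N. \<mu> x)"
    using S flip_cube \<mu>_nonneg by (intro sum_mono2) auto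
  also have "\<dots> = measure (unif_cube N) {u \<in> space (unif_cube N). round_vec N a u \<in> Sigma_cube N}"
    unfolding \<mu>_def by (rule measure_round_vec_mem(2)[symmetric]) simp
  also have "\<dots> \<le> 1" by (rule prob_le_1)
  finally show ?thesis .
qed

section \<open>Hamming distance and Hamming balls\<close>

definition hdist :: "nat \<Rightarrow> (nat \<Rightarrow> real) \<Rightarrow> (nat \<Rightarrow> real) \<Rightarrow> real" where
  "hdist N x y = real (card {i \<in> {1..N}. x i \<noteq> y i})"

lemma hdist_eq_sum: "hdist N x y = (\<Sum>i=1..N. of_bool (x i \<noteq> y i))"
  by (simp add: hdist_def sum_of_bool_eq Int_def)

text \<open>Markov's inequality: coordinate \<open>i\<close> disagrees with its sign with
  probability \<open>flip_prob (a i)\<close>, so the sum is the expected distance.\<close>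

lemma round_vec_hdist:
  assumes "r > 0"
  shows "measure (unif_cube N) {u \<in> space (unif_cube N). hdist N (round_vec N a u) (\<lambda>i. rsign (a i)) \<ge> r}
    \<le> (\<Sum>i=1..N. flip_prob (a i)) / r"
proof -
  interpret P: prob_space "unif_cube N"
    unfolding unif_cube_eq by (rule U.PM.prob_space_axioms)
  let ?B = "\<lambda>i. {u \<in> space (unif_cube N). rsign (a i - u i) = - rsign (a i)}"
  have B: "?B i \<in> sets (unif_cube N)" "measure (unif_cube N) (?B i) = flip_prob (a i)" if i: "i \<in> {1..N}" for i
  proof -
    have comp: "(\<lambda>u. u i) \<in> measurable (unif_cube N) (uniform_measure lborel {-1..1})"
      using i by (auto simp: unif_cube_def)
    have eq: "?B i = (\<lambda>u. u i) -` {u. rsign (a i - u) = - rsign (a i)} \<inter> space (unif_cube N)" by auto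
    show "?B i \<in> sets (unif_cube N)"
      unfolding eq by (rule measurable_sets[OF comp]) simp
    have "distr (unif_cube N) (uniform_measure lborel {-1..1}) (\<lambda>u. u i) = uniform_measure lborel {-1..1}"
      unfolding unif_cube_def using i U.prob_space_axioms by (intro distr_PiM_component) auto
    then have "flip_prob (a i) = measure (distr (unif_cube N) (uniform_measure lborel {-1..1}) (\<lambda>u. u i))
        {u. rsign (a i - u) = - rsign (a i)}"
      using sign_prob_uminus_rsign[of "a i"] by (simp add: sign_prob_def)
    also have "\<dots> = measure (unif_cube N) (?B i)"
      unfolding eq by (rule measure_distr[OF comp]) simp
    finally show "measure (unif_cube N) (?B i) = flip_prob (a i)" by simp
  qed
  have dist_eq: "hdist N (round_vec N a u) (\<lambda>i. rsign (a i)) = (\<Sum>i=1..N. indicator (?B i) u)"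
    if "u \<in> space (unif_cube N)" for u
    unfolding hdist_eq_sum using that
    by (intro sum.cong refl) (auto simp: round_vec_def rsign_def indicator_def)
  have "measure (unif_cube N) {u \<in> space (unif_cube N). hdist N (round_vec N a u) (\<lambda>i. rsign (a i)) \<ge> r}
      = measure (unif_cube N) {u \<in> space (unif_cube N). (\<Sum>i=1..N. indicator (?B i) u) \<ge> r}"
    using dist_eq by (intro arg_cong[where f = "measure (unif_cube N)"]) auto
  also have "\<dots> \<le> (\<integral>u. (\<Sum>i=1..N. indicator (?B i) u) \<partial>unif_cube N) / r"
    using B assms by (intro integral_Markov_inequality_measure[of _ _ "space (unif_cube N)"])
      (auto intro!: sum_nonneg Bochner_Integration.integrable_sum P.integrable_const_bound[of _ 1])
  also have "(\<integral>u. (\<Sum>i=1..N. indicator (?B i) u) \<partial>unif_cube N) = (\<Sum>i=1..N. flip_prob (a i))"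
    using B by (subst Bochner_Integration.integral_sum)
      (auto intro!: P.integrable_const_bound[of _ 1])
  finally show ?thesis .
qed

text \<open>Give each point of the cube the weight \<open>z\<close> to the power of its distance
  from \<open>s\<close>. The weights factor over coordinates with total \<open>(1 + z) ^ N\<close>,
  and as \<open>z\<close> is at most 1 each point of the ball weighs at least
  \<open>z powr R\<close>.\<close>

lemma card_hdist_ball_le:
  fixes z R :: real
  assumes z: "0 < z" "z \<le> 1" and s: "\<And>i. s i \<in> {-1, 1}"
  shows "real (card {x \<in> Sigma_cube N. hdist N x s \<le> R}) * z powr R \<le> exp (z * real N)"
proof -
  have "real (card {x \<in> Sigma_cube N. hdist N x s \<le> R}) * z powr R
      = (\<Sum>x\<in>{x \<in> Sigma_cube N. hdist N x s \<le> R}. z powr R)" by simp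
  also have "\<dots> \<le> (\<Sum>x\<in>{x \<in> Sigma_cube N. hdist N x s \<le> R}. \<Prod>i=1..N. z powr of_bool (x i \<noteq> s i))"
  proof (intro sum_mono)
    fix x assume x: "x \<in> {x \<in> Sigma_cube N. hdist N x s \<le> R}"
    have "z powr R \<le> z powr hdist N x s"
      using x z by (intro powr_mono') auto
    also have "\<dots> = (\<Prod>i=1..N. z powr of_bool (x i \<noteq> s i))"
      unfolding hdist_eq_sum using z by (subst powr_sum) auto
    finally show "z powr R \<le> (\<Prod>i=1..N. z powr of_bool (x i \<noteq> s i))" .
  qed
  also have "\<dots> \<le> (\<Sum>x\<in>Sigma_cube N. \<Prod>i=1..N. z powr of_bool (x i \<noteq> s i))"
    by (intro sum_mono2) (auto intro!: prod_nonneg)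
  also have "\<dots> = (\<Prod>i=1..N. \<Sum>\<sigma>\<in>{-1, 1}. z powr of_bool (\<sigma> \<noteq> s i))"
    unfolding Sigma_cube_def by (subst prod_sum_PiE) auto
  also have "\<dots> = (1 + z) ^ N"
  proof -
    have "(\<Sum>\<sigma>\<in>{-1, 1}. z powr of_bool (\<sigma> \<noteq> s i)) = 1 + z" for i
      using s[of i] z by auto
    then show ?thesis by simp
  qed
  also have "\<dots> \<le> exp z ^ N"
    using z by (intro power_mono) auto
  also have "\<dots> = exp (z * real N)"
    by (simp add: exp_of_nat_mult[symmetric] mult.commute)
  finally show ?thesis .
qed

section \<open>Bounds for fixed dimension\<close>

definition neg_pow :: "real \<Rightarrow> real" where
  "neg_pow E = 2 powr (- E)"

lemma neg_pow_nonneg [simp]: "0 \<le> neg_pow E"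
  by (simp add: neg_pow_def)

lemma solution_set_iff:
  "x \<in> solution_set N E g \<longleftrightarrow> x \<in> Sigma_cube N \<and> \<bar>\<Sum>i=1..N. g i * x i\<bar> \<le> neg_pow E"
  by (simp add: solution_set_def neg_pow_def)

lemma Sigma_cube_sign: "x \<in> Sigma_cube N \<Longrightarrow> i \<in> {1..N} \<Longrightarrow> x i = -1 \<or> x i = 1"
  using PiE_mem[of x "{1..N}" "\<lambda>_. {-1, 1}" i] by (auto simp: Sigma_cube_def)

lemma space_gauss: "space (gauss N) = {1..N} \<rightarrow>\<^sub>E UNIV"
  by (simp add: gauss_def space_PiM)

lemma prob_space_gauss: "prob_space (gauss N)"
  unfolding gauss_def by (rule G.PM.prob_space_axioms)

lemma prob_space_unif_cube: "prob_space (unif_cube N)"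
  unfolding unif_cube_eq by (rule U.PM.prob_space_axioms)

lemma measurable_gauss_component: "i \<in> {1..N} \<Longrightarrow> (\<lambda>g. g i) \<in> borel_measurable (gauss N)"
  using measurable_component_singleton[of i "{1..N}" "\<lambda>_. std_normal"] by (simp add: gauss_def)

lemma measurable_unif_cube_component: "i \<in> {1..N} \<Longrightarrow> (\<lambda>u. u i) \<in> borel_measurable (unif_cube N)"
  using measurable_component_singleton[of i "{1..N}" "\<lambda>_. uniform_measure lborel {-1..1::real}"]
  by (simp add: unif_cube_def)

text \<open>The exceptional instances on which two solutions might differ in exactly two coordinates
  \<open>i\<close> and \<open>j\<close>; \<sigma> stands for the product of the two signs of a
  solution.\<close>

definition two_flip :: "nat \<Rightarrow> real \<Rightarrow> (nat \<Rightarrow> real) set" where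
  "two_flip N e = {g \<in> space (gauss N).
     \<exists>p\<in>{(i, j, \<sigma>) \<in> {1..N} \<times> {1..N} \<times> {-1, 1}. i \<noteq> j}. \<bar>g (fst p) + g (fst (snd p)) * snd (snd p)\<bar> \<le> e}"

text \<open>A union bound over at most \<open>2 * N * N\<close> triples. For each of them,
  resampling \<open>g i\<close> with the rest fixed leaves an interval to be hit.\<close>

lemma measure_two_flip:
  assumes "e \<ge> 0"
  shows "two_flip N e \<in> sets (gauss N)" "measure (gauss N) (two_flip N e) \<le> 2 * (real N)\<^sup>2 * e"
proof -
  interpret prob_space "gauss N" by (rule prob_space_gauss)
  define T where "T = {(i, j, \<sigma>) \<in> {1..N} \<times> {1..N} \<times> {-1, 1::real}. i \<noteq> j}"
  define F where "F p = {g \<in> space (gauss N). \<bar>g (fst p) + g (fst (snd p)) * snd (snd p)\<bar> \<le> e}"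
    for p :: "nat \<times> nat \<times> real"
  have T: "finite T" "card T \<le> N * (N * 2)"
  proof -
    have sub: "T \<subseteq> {1..N} \<times> {1..N} \<times> {-1, 1::real}" by (auto simp: T_def)
    show "finite T" by (rule finite_subset[OF sub]) auto
    have "card T \<le> card ({1..N} \<times> {1..N} \<times> {-1, 1::real})"
      by (rule card_mono[OF _ sub]) auto
    then show "card T \<le> N * (N * 2)" by (simp add: card_cartesian_product mult_2_right)
  qed
  have F_sets: "F p \<in> sets (gauss N)" if "p \<in> T" for p
  proof -
    have [measurable]: "(\<lambda>g. g (fst p)) \<in> borel_measurable (gauss N)"
      "(\<lambda>g. g (fst (snd p))) \<in> borel_measurable (gauss N)"
      using that by (auto simp: T_def intro!: measurable_gauss_component)
    show ?thesis unfolding F_def by measurable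
  qed
  have F_le: "measure (gauss N) (F p) \<le> e" if "p \<in> T" for p
  proof -
    obtain i j \<sigma> where eq: "p = (i, j, \<sigma>)" by (cases p)
    have p: "p = (i, j, \<sigma>)" "i \<in> {1..N}" "j \<in> {1..N}" "\<bar>\<sigma>\<bar> = 1" "i \<noteq> j"
      using that by (auto simp: T_def eq)
    show ?thesis
      unfolding gauss_def
    proof (rule G.measure_le_resample[OF p(2) _ assms])
      show "F p \<in> sets (G.PM N)" using F_sets[OF that] by (simp add: gauss_def)
      fix g assume g: "g \<in> space (G.PM N)"
      have "{y \<in> space std_normal. g(i := y) \<in> F p} = {y. \<bar>g j * \<sigma> + y * 1\<bar> \<le> e}"
        using p g by (auto simp: F_def space_gauss space_PiM PiE_iff extensional_def add.commute)
      then show "measure std_normal {y \<in> space std_normal. g(i := y) \<in> F p} \<le> e"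
        using std_normal_small_ball[OF assms, of 1 "g j * \<sigma>"] by simp
    qed
  qed
  have eq: "two_flip N e = (\<Union>p\<in>T. F p)"
    unfolding two_flip_def T_def F_def by blast
  show "two_flip N e \<in> sets (gauss N)"
    unfolding eq using T F_sets by (intro sets.finite_UN) auto
  have "measure (gauss N) (two_flip N e) \<le> (\<Sum>p\<in>T. measure (gauss N) (F p))"
    unfolding eq using T F_sets by (intro finite_measure_subadditive_finite) auto
  also have "\<dots> \<le> real (card T) * e"
    using sum_bounded_above[of T "\<lambda>p. measure (gauss N) (F p)" e] F_le by simp
  also have "\<dots> \<le> real (N * (N * 2)) * e"
    using T assms by (intro mult_right_mono) linarith+
  finally show "measure (gauss N) (two_flip N e) \<le> 2 * (real N)\<^sup>2 * e"
    by (simp add: power2_eq_square mult_ac)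
qed

text \<open>The two flips change the sum from \<open>S + a\<close> to \<open>S - a\<close>, where
  \<open>a = g i * x i + g j * x j\<close>. If both are within the tolerance, so is
  \<open>a\<close>, which up to sign is \<open>g i + g j * (x i * x j)\<close>.\<close>

lemma solutions_not_two_flips_apart:
  assumes g: "g \<in> space (gauss N)" "g \<notin> two_flip N (neg_pow E)"
    and x: "x \<in> solution_set N E g" and ij: "i \<in> {1..N}" "j \<in> {1..N}" "i \<noteq> j"
  shows "flip j (flip i x) \<notin> solution_set N E g"
proof
  assume y: "flip j (flip i x) \<in> solution_set N E g"
  have cube: "x \<in> Sigma_cube N" using x by (simp add: solution_set_iff)
  define S where "S = (\<Sum>k\<in>{1..N} - {i} - {j}. g k * x k)"
  have split: "(\<Sum>k=1..N. f k) = f i + f j + (\<Sum>k\<in>{1..N} - {i} - {j}. f k)" for f :: "nat \<Rightarrow> real"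
    using ij by (subst sum.remove[of _ i], simp, simp, subst sum.remove[of _ j]) auto
  have sx: "(\<Sum>k=1..N. g k * x k) = g i * x i + g j * x j + S"
    unfolding S_def by (rule split)
  have sy: "(\<Sum>k=1..N. g k * flip j (flip i x) k) = - (g i * x i) - g j * x j + S"
    unfolding S_def split using ij by (auto simp: flip_def intro!: sum.cong)
  have "\<bar>g i * x i + g j * x j\<bar> \<le> neg_pow E"
    using x y unfolding solution_set_iff sx sy by linarith
  moreover have "\<bar>g i * x i + g j * x j\<bar> = \<bar>g i + g j * (x i * x j)\<bar>"
    using Sigma_cube_sign[OF cube ij(1)] Sigma_cube_sign[OF cube ij(2)] by (auto simp: abs_if)
  moreover have "x i * x j \<in> {-1, 1}"
    using Sigma_cube_sign[OF cube ij(1)] Sigma_cube_sign[OF cube ij(2)] by auto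
  ultimately have "g \<in> two_flip N (neg_pow E)"
    using g(1) ij by (auto simp: two_flip_def intro!: bexI[of _ "(i, j, x i * x j)"])
  with g(2) show False by simp
qed

section \<open>Decisive outputs: perturbation of the sign vector and nearby solutions\<close>

abbreviation sign_vec :: "(nat \<Rightarrow> real) \<Rightarrow> nat \<Rightarrow> real" where
  "sign_vec a \<equiv> \<lambda>i. rsign (a i)"

lemma hdist_triangle: "hdist N x z \<le> hdist N x y + hdist N y z"
  unfolding hdist_eq_sum sum.distrib[symmetric] by (intro sum_mono) auto

text \<open>Where the signs differ, either \<open>a i\<close> is at most 1/2 in absolute value and
  its flip probability is at least 1/4, or \<open>b i\<close> is at distance at least 1/2 from it.
  Both cases yield the factor 4.\<close>

lemma hdist_sign_vec_le:
  "hdist N (sign_vec b) (sign_vec a) \<le> 4 * (\<Sum>i=1..N. flip_prob (a i)) + 4 * (\<Sum>i=1..N. (a i - b i)\<^sup>2)"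
proof -
  have "of_bool (rsign (b i) \<noteq> rsign (a i)) \<le> 4 * flip_prob (a i) + 4 * (a i - b i)\<^sup>2" for i
  proof (cases "rsign (b i) \<noteq> rsign (a i) \<and> \<bar>a i\<bar> > 1 / 2")
    case True
    then have "\<bar>a i - b i\<bar> \<ge> 1 / 2" by (auto simp: rsign_def split: if_splits)
    then have "(1 / 2)\<^sup>2 \<le> \<bar>a i - b i\<bar>\<^sup>2" by (intro power_mono) auto
    then show ?thesis using flip_prob_nonneg[of "a i"] by (simp add: power2_eq_square)
  next
    case False
    show ?thesis
    proof (cases "rsign (b i) = rsign (a i)")
      case True
      then show ?thesis by (simp add: flip_prob_nonneg)
    next
      case neq: False
      with False have "1 \<le> 4 * flip_prob (a i)" by (auto simp: flip_prob_def)
      then show ?thesis using neq by (simp add: add_increasing2)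
    qed
  qed
  then show ?thesis
    unfolding hdist_eq_sum sum_distrib_left sum.distrib[symmetric] by (intro sum_mono) auto
qed

lemma hdist_sign_vec_measurable:
  assumes "\<And>i. i \<in> {1..N} \<Longrightarrow> (\<lambda>g. A g i) \<in> borel_measurable M"
  shows "(\<lambda>g. hdist N x (sign_vec (A g))) \<in> borel_measurable M"
proof -
  have eq: "hdist N x (sign_vec (A g)) = (\<Sum>i=1..N. if 0 < A g i then of_bool (x i \<noteq> 1) else of_bool (x i \<noteq> -1))" for g
    unfolding hdist_eq_sum by (intro sum.cong) (auto simp: rsign_def)
  have "{g \<in> space M. 0 < A g i} \<in> sets M" if "i \<in> {1..N}" for i
    using assms[OF that] by measurable
  then show ?thesis
    unfolding eq by (intro borel_measurable_sum measurable_If) auto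
qed

text \<open>The event \<open>B\<close> of the outline. Decisiveness is included because it controls
  how far the sign vector moves when \<open>A g\<close> is perturbed.\<close>

definition near_solution ::
    "nat \<Rightarrow> real \<Rightarrow> ((nat \<Rightarrow> real) \<Rightarrow> nat \<Rightarrow> real) \<Rightarrow> real \<Rightarrow> real \<Rightarrow> (nat \<Rightarrow> real) set" where
  "near_solution N E A M r = {g \<in> space (gauss N). (\<Sum>i=1..N. flip_prob (A g i)) < M \<and>
     (\<exists>x\<in>solution_set N E g. hdist N x (sign_vec (A g)) \<le> r)}"

lemma measurable_flip_prob [measurable]: "flip_prob \<in> borel_measurable borel"
  unfolding flip_prob_def by measurable

lemma near_solution_sets:
  assumes A: "\<And>i. i \<in> {1..N} \<Longrightarrow> (\<lambda>g. A g i) \<in> borel_measurable (gauss N)"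
  shows "near_solution N E A M r \<in> sets (gauss N)"
proof -
  have "(\<lambda>g. \<Sum>i=1..N. flip_prob (A g i)) \<in> borel_measurable (gauss N)"
    by (intro borel_measurable_sum measurable_compose[OF A measurable_flip_prob])
  then have 1: "{g \<in> space (gauss N). (\<Sum>i=1..N. flip_prob (A g i)) < M} \<in> sets (gauss N)"
    by measurable
  have 2: "{g \<in> space (gauss N). \<bar>\<Sum>i=1..N. g i * x i\<bar> \<le> neg_pow E \<and> hdist N x (sign_vec (A g)) \<le> r} \<in> sets (gauss N)" for x
  proof -
    have "(\<lambda>g. \<Sum>i=1..N. g i * x i) \<in> borel_measurable (gauss N)"
      by (intro borel_measurable_sum borel_measurable_times measurable_gauss_component) auto
    moreover have "(\<lambda>g. hdist N x (sign_vec (A g))) \<in> borel_measurable (gauss N)"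
      using A by (rule hdist_sign_vec_measurable)
    ultimately show ?thesis by measurable
  qed
  have "near_solution N E A M r = {g \<in> space (gauss N). (\<Sum>i=1..N. flip_prob (A g i)) < M} \<inter>
      (\<Union>x\<in>Sigma_cube N. {g \<in> space (gauss N). \<bar>\<Sum>i=1..N. g i * x i\<bar> \<le> neg_pow E \<and> hdist N x (sign_vec (A g)) \<le> r})"
    by (auto simp: near_solution_def solution_set_iff)
  then show ?thesis using 1 2 by (auto intro!: sets.Int sets.finite_UN)
qed

text \<open>The sign vector is computed from \<open>fst z\<close> and does not see the fresh value
  \<open>snd z\<close>. Given \<open>fst z\<close>, each of the at most \<open>K\<close> candidates
  in the ball confines that value to an interval of probability at most
  \<open>neg_pow E\<close>.\<close>

lemma measure_resampled_solution_near:
  fixes K R E :: real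
  assumes i: "i \<in> {1..N}" and K: "\<And>s. (\<And>i. s i \<in> {-1, 1}) \<Longrightarrow> real (card {x \<in> Sigma_cube N. hdist N x s \<le> R}) \<le> K"
    and A: "\<And>i. i \<in> {1..N} \<Longrightarrow> (\<lambda>g. A g i) \<in> borel_measurable (gauss N)"
  defines "T \<equiv> {z \<in> space (G.PM N \<Otimes>\<^sub>M std_normal).
    \<exists>x\<in>solution_set N E ((fst z)(i := snd z)). hdist N x (sign_vec (A (fst z))) \<le> R}"
  shows "T \<in> sets (G.PM N \<Otimes>\<^sub>M std_normal)" "measure (G.PM N \<Otimes>\<^sub>M std_normal) T \<le> K * neg_pow E"
proof -
  let ?P = "G.PM N \<Otimes>\<^sub>M std_normal"
  have K0: "0 \<le> K" using K[of "\<lambda>_. 1"] by (auto intro: order_trans[OF of_nat_0_le_iff])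
  show T_sets: "T \<in> sets ?P"
  proof -
    have "{z \<in> space ?P. \<bar>\<Sum>j=1..N. ((fst z)(i := snd z)) j * x j\<bar> \<le> neg_pow E \<and> hdist N x (sign_vec (A (fst z))) \<le> R} \<in> sets ?P" for x
    proof -
      have "(\<lambda>z. (fst z)(i := snd z)) \<in> ?P \<rightarrow>\<^sub>M gauss N"
        using G.fun_upd_measurable[OF i] by (simp add: gauss_def case_prod_unfold)
      from measurable_compose[OF this measurable_gauss_component]
      have "(\<lambda>z. \<Sum>j=1..N. ((fst z)(i := snd z)) j * x j) \<in> borel_measurable ?P"
        by (intro borel_measurable_sum borel_measurable_times borel_measurable_const)
      moreover have "fst \<in> ?P \<rightarrow>\<^sub>M gauss N" by (simp add: gauss_def)
      then have "(\<lambda>z. hdist N x (sign_vec (A (fst z)))) \<in> borel_measurable ?P"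
        by (rule measurable_compose[OF _ hdist_sign_vec_measurable[OF A]])
      ultimately show ?thesis by measurable
    qed
    note sets = this
    have "z \<in> T \<longleftrightarrow> z \<in> (\<Union>x\<in>Sigma_cube N. {z \<in> space ?P. \<bar>\<Sum>j=1..N. ((fst z)(i := snd z)) j * x j\<bar> \<le> neg_pow E \<and> hdist N x (sign_vec (A (fst z))) \<le> R})" for z
      unfolding T_def solution_set_iff mem_Collect_eq UN_iff Bex_def by (rule iffI; elim exE conjE; intro exI conjI)
    then have eq: "T = (\<Union>x\<in>Sigma_cube N. {z \<in> space ?P. \<bar>\<Sum>j=1..N. ((fst z)(i := snd z)) j * x j\<bar> \<le> neg_pow E \<and> hdist N x (sign_vec (A (fst z))) \<le> R})"
      by (rule set_eqI)
    show ?thesis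
      unfolding eq by (rule sets.finite_UN[OF finite_Sigma_cube sets])
  qed
  show "measure ?P T \<le> K * neg_pow E"
  proof (rule measure_pair_le[OF G.PM.prob_space_axioms G.prob_space_axioms T_sets])
    show "0 \<le> K * neg_pow E" using K0 by simp
    fix g assume g: "g \<in> space (G.PM N)"
    define X where "X = {x \<in> Sigma_cube N. hdist N x (sign_vec (A g)) \<le> R}"
    define b where "b x = (\<Sum>j\<in>{1..N} - {i}. g j * x j)" for x
    have X: "finite X" "real (card X) \<le> K"
      unfolding X_def by simp (rule K, simp add: rsign_def)
    have sum_eq: "(\<Sum>j=1..N. (g(i := y)) j * x j) = b x + y * x i" for x y
      unfolding b_def using i by (subst sum.remove[of _ i]) (auto intro!: sum.cong)
    have sub: "Pair g -` T = (\<Union>x\<in>X. {y. \<bar>b x + y * x i\<bar> \<le> neg_pow E})"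
    proof -
      have "(g, y) \<in> T \<longleftrightarrow> (\<exists>x\<in>solution_set N E (g(i := y)). hdist N x (sign_vec (A g)) \<le> R)" for y
        using g by (simp add: T_def space_pair_measure del: fun_upd_apply)
      then have "(g, y) \<in> T \<longleftrightarrow> (\<exists>x\<in>X. \<bar>b x + y * x i\<bar> \<le> neg_pow E)" for y
        unfolding Bex_def X_def mem_Collect_eq solution_set_iff sum_eq by blast
      then show ?thesis by auto
    qed
    have "measure std_normal (Pair g -` T) \<le> (\<Sum>x\<in>X. measure std_normal {y. \<bar>b x + y * x i\<bar> \<le> neg_pow E})"
      unfolding sub using X by (intro G.finite_measure_subadditive_finite) auto
    also have "\<dots> \<le> (\<Sum>x\<in>X. neg_pow E)"
      using Sigma_cube_sign[OF _ i] by (intro sum_mono std_normal_small_ball) (force simp: X_def)+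
    also have "\<dots> \<le> K * neg_pow E"
      using X by (simp add: mult_right_mono)
    finally show "measure std_normal (Pair g -` T) \<le> K * neg_pow E" .
  qed
qed

text \<open>If both vectors of a resampled pair lie in the event, either the output moved by squared
  distance at least \<open>t / 4\<close>, or the old sign vector is close to a solution of the new
  instance. Markov's inequality and total influence handle the former, the union bound the
  latter.\<close>

lemma measure_near_solution:
  fixes K M r t :: real
  assumes N: "N \<ge> 1" and alg: "coord_degree_algorithm N D A"
    and C: "(\<integral>g. (L2_set (A g) {1..N})\<^sup>2 \<partial>gauss N) \<le> C * real N" and t: "t > 0"
    and K: "\<And>s. (\<And>i. s i \<in> {-1, 1}) \<Longrightarrow> real (card {x \<in> Sigma_cube N. hdist N x s \<le> r + 4 * M + t}) \<le> K"
  shows "(measure (gauss N) (near_solution N E A M r))\<^sup>2 \<le> 8 * C * real D / t + K * neg_pow E"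
proof -
  let ?P = "G.PM N \<Otimes>\<^sub>M std_normal"
  let ?B = "near_solution N E A M r"
  have A: "(\<lambda>g. A g i) \<in> borel_measurable (gauss N)" if "i \<in> {1..N}" for i
    using G.L2_measurable[OF coord_degree_algorithm_component(1)[OF alg that]] by (simp add: gauss_def)
  define \<Delta> where "\<Delta> i = (\<lambda>(g, y). \<Sum>j=1..N. (A g j - A (g(i := y)) j)\<^sup>2)" for i
  have step: "(measure (gauss N) ?B)\<^sup>2 \<le> (\<integral>z. \<Delta> i z \<partial>?P) / (t / 4) + K * neg_pow E" if i: "i \<in> {1..N}" for i
  proof -
    define Q where "Q = {(g, y) \<in> space ?P. g \<in> ?B \<and> g(i := y) \<in> ?B}"
    define F where "F = {z \<in> space ?P. \<Delta> i z \<ge> t / 4}"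
    define T where "T = {z \<in> space ?P. \<exists>x\<in>solution_set N E ((fst z)(i := snd z)).
      hdist N x (sign_vec (A (fst z))) \<le> r + 4 * M + t}"
    note T = measure_resampled_solution_near[where A = A and E = E, OF i K A, folded T_def]
    have int: "integrable ?P (\<Delta> i)"
      unfolding \<Delta>_def by (rule sum_resample_stability(1)[OF alg i])
    have F_sets: "F \<in> sets ?P"
      unfolding F_def using borel_measurable_integrable[OF int] by measurable
    \<comment> \<open>Triangle inequality through the new sign vector: \<open>r\<close> to the
      solution, then \<open>4 * M\<close> from decisiveness of the old output and \<open>t\<close>
      from four times a displacement below \<open>t / 4\<close>.\<close>
    have "Q \<subseteq> F \<union> T"
    proof
      fix z assume z: "z \<in> Q"
      obtain g y where gy: "z = (g, y)" by (cases z)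
      from z have sp: "(g, y) \<in> space ?P" and g: "g \<in> ?B" and g': "g(i := y) \<in> ?B"
        by (auto simp: Q_def gy)
      show "z \<in> F \<union> T"
      proof (cases "\<Delta> i z \<ge> t / 4")
        case True
        then show ?thesis using sp by (auto simp: F_def gy)
      next
        case False
        from g' obtain x where x: "x \<in> solution_set N E (g(i := y))" "hdist N x (sign_vec (A (g(i := y)))) \<le> r"
          by (auto simp: near_solution_def)
        have "hdist N (sign_vec (A (g(i := y)))) (sign_vec (A g)) \<le> 4 * (\<Sum>j=1..N. flip_prob (A g j)) + 4 * \<Delta> i z"
          using hdist_sign_vec_le[of N "A (g(i := y))" "A g"] by (simp add: \<Delta>_def gy)
        also have "\<dots> \<le> 4 * M + t" using g False by (auto simp: near_solution_def)
        finally have "hdist N x (sign_vec (A g)) \<le> r + 4 * M + t"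
          using x(2) hdist_triangle[of N x "sign_vec (A g)" "sign_vec (A (g(i := y)))"] by linarith
        then show ?thesis using x(1) sp by (auto simp: T_def gy)
      qed
    qed
    have "(measure (gauss N) ?B)\<^sup>2 \<le> measure ?P Q"
      unfolding Q_def gauss_def
      by (rule G.measure_resample_pair[OF i]) (use near_solution_sets[OF A] in \<open>simp add: gauss_def\<close>)
    also have "\<dots> \<le> measure ?P (F \<union> T)"
      using \<open>Q \<subseteq> F \<union> T\<close> F_sets T(1) by (intro G.PM_pair_prob.finite_measure_mono) auto
    also have "\<dots> \<le> measure ?P F + measure ?P T"
      using F_sets T(1) by (rule measure_Un_le)
    also have "measure ?P F \<le> (\<integral>z. \<Delta> i z \<partial>?P) / (t / 4)"
      unfolding F_def using int t
      by (intro integral_Markov_inequality_measure[OF int sets.top]) (auto simp: \<Delta>_def intro!: sum_nonneg)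
    finally show ?thesis using T(2) by simp
  qed
  \<comment> \<open>Summing over \<open>i\<close> and dividing by \<open>N\<close> replaces the
    random choice of the coordinate; the factor \<open>N\<close> of the moment bound
    cancels.\<close>
  have "real N * (measure (gauss N) ?B)\<^sup>2 = (\<Sum>i=1..N. (measure (gauss N) ?B)\<^sup>2)" by simp
  also have "\<dots> \<le> (\<Sum>i=1..N. (\<integral>z. \<Delta> i z \<partial>?P) / (t / 4) + K * neg_pow E)"
    by (intro sum_mono step)
  also have "\<dots> = (\<Sum>i=1..N. \<integral>z. \<Delta> i z \<partial>?P) / (t / 4) + real N * (K * neg_pow E)"
    unfolding sum.distrib sum_divide_distrib by simp
  also have "(\<Sum>i=1..N. \<integral>z. \<Delta> i z \<partial>?P) \<le> 2 * real D * (\<integral>g. (L2_set (A g) {1..N})\<^sup>2 \<partial>gauss N)"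
    unfolding \<Delta>_def by (rule sum_resample_stability(2)[OF alg])
  also have "\<dots> \<le> 2 * real D * (C * real N)"
    using C by (intro mult_left_mono) auto
  finally have "real N * (measure (gauss N) ?B)\<^sup>2 \<le> 2 * real D * (C * real N) / (t / 4) + real N * (K * neg_pow E)"
    using t by (simp add: divide_right_mono)
  also have "\<dots> = real N * (8 * C * real D / t + K * neg_pow E)"
    by (simp add: algebra_simps)
  finally show ?thesis using N by simp
qed

text \<open>The four terms belong to four ways to succeed: an exceptional instance, an indecisive
  output, a decisive one whose rounding strays at least \<open>r\<close> from its sign vector, and a
  decisive one with a solution within \<open>r\<close>.\<close>

lemma success_prob_le:
  fixes M r :: real
  assumes alg: "coord_degree_algorithm N D A" and M: "M > 0" and r: "r > 0"
  shows "success_prob N A E \<le> 2 * (real N)\<^sup>2 * neg_pow E + 1 / M + M / r + measure (gauss N) (near_solution N E A M r)"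
proof -
  let ?P = "gauss N \<Otimes>\<^sub>M unif_cube N"
  interpret GN: prob_space "gauss N" by (rule prob_space_gauss)
  interpret UN: prob_space "unif_cube N" by (rule prob_space_unif_cube)
  interpret P: pair_prob_space "gauss N" "unif_cube N" ..
  have A: "(\<lambda>g. A g i) \<in> borel_measurable (gauss N)" if "i \<in> {1..N}" for i
    using G.L2_measurable[OF coord_degree_algorithm_component(1)[OF alg that]] by (simp add: gauss_def)
  define m where "m g = (\<Sum>i=1..N. flip_prob (A g i))" for g
  have m_meas: "m \<in> borel_measurable (gauss N)"
    unfolding m_def by (intro borel_measurable_sum measurable_compose[OF A measurable_flip_prob])
  have m_meas': "(\<lambda>z. m (fst z)) \<in> borel_measurable ?P"
    by (rule measurable_compose[OF measurable_fst m_meas])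
  have signs: "(\<lambda>z. rsign (A (fst z) i - snd z i)) \<in> borel_measurable ?P" if "i \<in> {1..N}" for i
  proof -
    have "rsign \<in> borel_measurable borel" unfolding rsign_def by measurable
    then show ?thesis
      by (rule measurable_compose[rotated]) (intro borel_measurable_diff
        measurable_compose[OF measurable_fst A] measurable_compose[OF measurable_snd measurable_unif_cube_component] that)
  qed
  define Bad where "Bad = two_flip N (neg_pow E)"
  define B where "B = near_solution N E A M r"
  define W where "W = {z \<in> space ?P. round_vec N (A (fst z)) (snd z) \<in> solution_set N E (fst z)}"
  define Q1 where "Q1 = W \<inter> {z \<in> space ?P. fst z \<notin> Bad \<and> M \<le> m (fst z)}"
  define Q2 where "Q2 = {z \<in> space ?P. m (fst z) < M \<and> r \<le> hdist N (round_vec N (A (fst z)) (snd z)) (sign_vec (A (fst z)))}"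
  have Bad: "Bad \<in> sets (gauss N)" "measure (gauss N) Bad \<le> 2 * (real N)\<^sup>2 * neg_pow E"
    unfolding Bad_def by (intro measure_two_flip neg_pow_nonneg)+
  have B: "B \<in> sets (gauss N)"
    unfolding B_def by (rule near_solution_sets[OF A])
  have W_sets: "W \<in> sets ?P"
  proof -
    have "W = {z \<in> space ?P. \<bar>\<Sum>i=1..N. fst z i * rsign (A (fst z) i - snd z i)\<bar> \<le> neg_pow E}"
      unfolding W_def solution_set_iff using round_vec_cube by (simp add: round_vec_def)
    moreover have "(\<lambda>z. \<Sum>i=1..N. fst z i * rsign (A (fst z) i - snd z i)) \<in> borel_measurable ?P"
      by (intro borel_measurable_sum borel_measurable_times signs
        measurable_compose[OF measurable_fst measurable_gauss_component])
    ultimately show ?thesis by simp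
  qed
  have Q1_sets: "Q1 \<in> sets ?P"
  proof -
    have "{z \<in> space ?P. fst z \<notin> Bad \<and> M \<le> m (fst z)} =
        (fst -` (space (gauss N) - Bad) \<inter> space ?P) \<inter> {z \<in> space ?P. M \<le> m (fst z)}"
      by (auto simp: space_pair_measure)
    moreover have "{z \<in> space ?P. M \<le> m (fst z)} \<in> sets ?P" using m_meas' by measurable
    moreover have "fst -` (space (gauss N) - Bad) \<inter> space ?P \<in> sets ?P"
      using Bad by (intro measurable_sets[OF measurable_fst]) auto
    ultimately show ?thesis unfolding Q1_def using W_sets by auto
  qed
  have Q2_sets: "Q2 \<in> sets ?P"
  proof -
    have "hdist N (round_vec N (A (fst z)) (snd z)) (sign_vec (A (fst z))) =
        (\<Sum>i=1..N. \<bar>rsign (A (fst z) i - snd z i) - rsign (A (fst z) i)\<bar> / 2)" for z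
      unfolding hdist_eq_sum by (intro sum.cong) (auto simp: round_vec_def rsign_def)
    moreover have "(\<lambda>z. \<Sum>i=1..N. \<bar>rsign (A (fst z) i - snd z i) - rsign (A (fst z) i)\<bar> / 2) \<in> borel_measurable ?P"
    proof -
      have "rsign \<in> borel_measurable borel" unfolding rsign_def by measurable
      from measurable_compose[OF measurable_compose[OF measurable_fst A] this]
      show ?thesis
        by (intro borel_measurable_sum borel_measurable_divide borel_measurable_abs borel_measurable_diff signs) auto
    qed
    ultimately have "(\<lambda>z. hdist N (round_vec N (A (fst z)) (snd z)) (sign_vec (A (fst z)))) \<in> borel_measurable ?P"
      by simp
    with m_meas' show ?thesis unfolding Q2_def by measurable
  qed
  have cover: "W \<subseteq> (Bad \<times> space (unif_cube N)) \<union> (Q1 \<union> (Q2 \<union> B \<times> space (unif_cube N)))"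
  proof
    fix z assume z: "z \<in> W"
    obtain g u where gu: "z = (g, u)" by (cases z)
    from z have sp: "g \<in> space (gauss N)" "u \<in> space (unif_cube N)" "(g, u) \<in> space ?P"
      and sol: "round_vec N (A g) u \<in> solution_set N E g"
      by (auto simp: W_def gu space_pair_measure)
    consider "g \<in> Bad" | "g \<notin> Bad" "M \<le> m g" | "m g < M" "r \<le> hdist N (round_vec N (A g) u) (sign_vec (A g))"
      | "m g < M" "hdist N (round_vec N (A g) u) (sign_vec (A g)) \<le> r"
      by linarith
    then show "z \<in> (Bad \<times> space (unif_cube N)) \<union> (Q1 \<union> (Q2 \<union> B \<times> space (unif_cube N)))"
    proof cases
      case 4
      then have "g \<in> B" using sp sol by (auto simp: B_def near_solution_def m_def)
      then show ?thesis using sp by (simp add: gu)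
    qed (use sp z in \<open>auto simp: gu Q1_def Q2_def\<close>)
  qed
  have Q1_le: "measure ?P Q1 \<le> 1 / M"
  proof (rule measure_pair_le[OF prob_space_gauss prob_space_unif_cube Q1_sets])
    fix g assume g: "g \<in> space (gauss N)"
    show "measure (unif_cube N) (Pair g -` Q1) \<le> 1 / M"
    proof (cases "g \<notin> Bad \<and> M \<le> m g")
      case True
      then have "Pair g -` Q1 = {u \<in> space (unif_cube N). round_vec N (A g) u \<in> solution_set N E g}"
        using g by (auto simp: Q1_def W_def space_pair_measure)
      moreover have "measure (unif_cube N) {u \<in> space (unif_cube N). round_vec N (A g) u \<in> solution_set N E g} * m g \<le> 1"
        unfolding m_def
        by (rule round_vec_separated)
          (use g True solutions_not_two_flips_apart in \<open>auto simp: Bad_def solution_set_iff\<close>)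
      moreover have "p \<le> 1 / M" if "p * m g \<le> 1" "0 \<le> p" for p
        using that True M mult_left_mono[of M "m g" p] by (simp add: field_simps)
      ultimately show ?thesis by simp
    next
      case False
      then have "Pair g -` Q1 = {}" by (auto simp: Q1_def)
      then show ?thesis using M by simp
    qed
  qed (use M in simp)
  have Q2_le: "measure ?P Q2 \<le> M / r"
  proof (rule measure_pair_le[OF prob_space_gauss prob_space_unif_cube Q2_sets])
    fix g assume g: "g \<in> space (gauss N)"
    show "measure (unif_cube N) (Pair g -` Q2) \<le> M / r"
    proof (cases "m g < M")
      case True
      then have "Pair g -` Q2 = {u \<in> space (unif_cube N). hdist N (round_vec N (A g) u) (sign_vec (A g)) \<ge> r}"
        using g by (auto simp: Q2_def space_pair_measure)
      then have "measure (unif_cube N) (Pair g -` Q2) \<le> m g / r"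
        using round_vec_hdist[OF r] by (simp add: m_def)
      also have "\<dots> \<le> M / r" using True r by (intro divide_right_mono) auto
      finally show ?thesis .
    next
      case False
      then have "Pair g -` Q2 = {}" by (auto simp: Q2_def)
      then show ?thesis using M r by simp
    qed
  qed (use M r in simp)
  have cyl: "measure ?P (X \<times> space (unif_cube N)) = measure (gauss N) X" if "X \<in> sets (gauss N)" for X
    using UN.emeasure_pair_measure_Times[OF that sets.top] by (simp add: measure_def UN.emeasure_space_1)
  have "success_prob N A E = measure ?P W"
    unfolding success_prob_def W_def rounding_def round_vec_def by (simp add: case_prod_unfold)
  also have "\<dots> \<le> measure ?P ((Bad \<times> space (unif_cube N)) \<union> (Q1 \<union> (Q2 \<union> B \<times> space (unif_cube N))))"
    using Bad B Q1_sets Q2_sets by (intro P.finite_measure_mono cover) auto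
  also have "\<dots> \<le> measure ?P (Bad \<times> space (unif_cube N)) + (measure ?P Q1 + (measure ?P Q2 + measure ?P (B \<times> space (unif_cube N))))"
    using Bad B Q1_sets Q2_sets
    by (intro order_trans[OF measure_Un_le] add_mono order_refl) auto
  also have "\<dots> \<le> 2 * (real N)\<^sup>2 * neg_pow E + (1 / M + (M / r + measure (gauss N) B))"
    using Bad B Q1_le Q2_le by (intro add_mono) (simp_all add: cyl)
  finally show ?thesis by (simp add: B_def)
qed

section \<open>Asymptotics\<close>

text \<open>The radius below which a union bound over the Hamming ball beats the probability \<open>2 powr - E\<close>.\<close>

definition radius :: "nat \<Rightarrow> real \<Rightarrow> real" where
  "radius N E = E / (4 * ln (4 * real N / E))"

text \<open>With weight \<open>z = E / (4 * N)\<close> the total weight is at most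
  \<open>exp (E / 4)\<close>, and \<open>radius\<close> is the exponent at which a power of
  \<open>z\<close> equals \<open>exp (- (E / 4))\<close>. The bound \<open>E < 4 * N\<close> keeps
  \<open>z\<close> below 1.\<close>

lemma card_radius_ball_le:
  assumes N: "N \<ge> 1" and E: "0 < E" "E < 4 * real N" and s: "\<And>i. s i \<in> {-1, 1}" and R: "R \<le> radius N E"
  shows "real (card {x \<in> Sigma_cube N. hdist N x s \<le> R}) \<le> exp (E / 2)"
proof -
  define z where "z = E / (4 * real N)"
  have z: "0 < z" "z \<le> 1" using N E by (auto simp: z_def)
  have pos: "0 < ln (4 * real N / E)" using E by simp
  have lnz: "ln z = - ln (4 * real N / E)"
    using N E by (simp add: z_def ln_div)
  have "radius N E * ln z = - (E / 4)"
    using pos unfolding lnz radius_def by (simp add: field_simps)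
  then have "exp (- (E / 4)) = z powr radius N E"
    using z by (simp add: powr_def)
  also have "\<dots> \<le> z powr R"
    using R z by (intro powr_mono') auto
  finally have "real (card {x \<in> Sigma_cube N. hdist N x s \<le> R}) * exp (- (E / 4))
      \<le> real (card {x \<in> Sigma_cube N. hdist N x s \<le> R}) * z powr R"
    by (rule mult_left_mono) simp
  also have "\<dots> \<le> exp (z * real N)"
    by (rule card_hdist_ball_le[OF z s])
  also have "z * real N = E / 4" using N by (simp add: z_def)
  finally have "real (card {x \<in> Sigma_cube N. hdist N x s \<le> R}) * exp (- (E / 4)) * exp (E / 4)
      \<le> exp (E / 4) * exp (E / 4)"
    by (rule mult_right_mono) simp
  then show ?thesis by (simp add: mult.assoc flip: exp_add)
qed

text \<open>The choices are \<open>r = M\<^sup>2\<close> and slack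
  \<open>t = radius N E / 2\<close>; the hypothesis on \<open>M\<close> makes
  \<open>r + 4 * M + t\<close> at most the radius.\<close>

lemma success_prob_le_radius:
  assumes N: "N \<ge> 1" and alg: "coord_degree_algorithm N D A" and C: "C > 0"
    and norm: "(\<integral>g. (L2_set (A g) {1..N})\<^sup>2 \<partial>gauss N) \<le> C * real N"
    and E: "0 < E" "E < 4 * real N" and M: "M > 0" "M\<^sup>2 + 4 * M \<le> radius N E / 2"
  shows "success_prob N A E \<le> 2 * (real N)\<^sup>2 * 2 powr (- E) + 2 / M
    + sqrt (16 * C * (real D / radius N E) + exp (- (E / 6)))"
proof -
  let ?k = "radius N E"
  have "0 < M\<^sup>2 + 4 * M" using M(1) by (simp add: add_pos_pos)
  with M(2) have k: "?k > 0" by linarith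
  let ?p = "measure (gauss N) (near_solution N E A M (M\<^sup>2))"
  have "?p\<^sup>2 \<le> 8 * C * real D / (?k / 2) + exp (E / 2) * neg_pow E"
    using M(2) k
    by (intro measure_near_solution[OF N alg norm] card_radius_ball_le[OF N E]) auto
  \<comment> \<open>As \<open>ln 2\<close> is at least 2/3, the total exponent is at most
    \<open>E / 2 - 2 * E / 3\<close>.\<close>
  also have "exp (E / 2) * neg_pow E \<le> exp (- (E / 6))"
  proof -
    have "E * (2 / 3) \<le> E * ln 2"
      using E ln2_ge_two_thirds by (intro mult_left_mono) auto
    then show ?thesis
      by (simp add: neg_pow_def powr_def flip: exp_add)
  qed
  also have "8 * C * real D / (?k / 2) = 16 * C * (real D / ?k)" by simp
  finally have "?p \<le> sqrt (16 * C * (real D / ?k) + exp (- (E / 6)))"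
    by (intro real_le_rsqrt) simp
  moreover have "1 / M + M / M\<^sup>2 = 2 / M"
    using M by (simp add: power2_eq_square field_simps)
  moreover have "M\<^sup>2 > 0" using M by simp
  ultimately show ?thesis
    using success_prob_le[OF alg M(1), of "M\<^sup>2" E] by (simp add: neg_pow_def)
qed

text \<open>Both regimes enter the limit only through these three consequences. Landau symbols
  compare absolute values, so regime (b) states the positivity of \<open>E\<close>
  separately.\<close>

lemma energy_asymptotics:
  fixes D :: "nat \<Rightarrow> nat" and E :: "nat \<Rightarrow> real"
  assumes "(\<exists>\<delta>::real. 0 < \<delta> \<and> \<delta> < 1 \<and> (\<forall>N\<ge>1. E N = \<delta> * real N) \<and>
             (\<lambda>N. real (D N)) \<in> o(\<lambda>N. real N))
       \<or> ((\<forall>\<^sub>F N in sequentially. E N > 0) \<and>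
             E \<in> \<omega>(\<lambda>N. (ln (real N))\<^sup>2) \<and> E \<in> o(\<lambda>N. real N) \<and>
             (\<lambda>N. real (D N)) \<in> o(\<lambda>N. E N / (ln (real N / E N))\<^sup>2))"
  shows "\<forall>\<^sub>F N in sequentially. 0 < E N \<and> E N < 4 * real N \<and> 6 * ln (real N) \<le> E N"
    and "filterlim (\<lambda>N. radius N (E N)) at_top sequentially"
    and "(\<lambda>N. real (D N) / radius N (E N)) \<longlonglongrightarrow> 0"
proof -
  have "(\<forall>\<^sub>F N in sequentially. 0 < E N \<and> E N < 4 * real N \<and> 6 * ln (real N) \<le> E N)
    \<and> filterlim (\<lambda>N. radius N (E N)) at_top sequentially
    \<and> (\<lambda>N. real (D N) / radius N (E N)) \<longlonglongrightarrow> 0"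
    using assms
  proof (elim disjE exE conjE)
    fix \<delta> :: real
    assume \<delta>: "0 < \<delta>" "\<delta> < 1" and E: "\<forall>N\<ge>1. E N = \<delta> * real N"
      and D: "(\<lambda>N. real (D N)) \<in> o(\<lambda>N. real N)"
    \<comment> \<open>In the linear regime \<open>N / E\<close> is constant, so the radius is
      exactly \<open>c * N\<close>.\<close>
    define c where "c = \<delta> / (4 * ln (4 / \<delta>))"
    have c: "c > 0" using \<delta> by (simp add: c_def)
    have ev1: "\<forall>\<^sub>F N in sequentially. N \<ge> (1::nat)" by (rule eventually_ge_at_top)
    have radius: "\<forall>\<^sub>F N in sequentially. radius N (E N) = c * real N"
      using ev1 by eventually_elim (use E \<delta> in \<open>simp add: radius_def c_def\<close>)
    have "\<forall>\<^sub>F N in sequentially. 6 * ln (real N) \<le> \<delta> * real N"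
      using \<delta>(1) by real_asymp
    then have "\<forall>\<^sub>F N in sequentially. 0 < E N \<and> E N < 4 * real N \<and> 6 * ln (real N) \<le> E N"
      using ev1
    proof eventually_elim
      case (elim N)
      have "\<delta> * real N \<le> 1 * real N" using \<delta> by (intro mult_right_mono) auto
      then show ?case using elim E \<delta> by auto
    qed
    moreover have "filterlim (\<lambda>N. c * real N) at_top sequentially"
      using c by real_asymp
    then have "filterlim (\<lambda>N. radius N (E N)) at_top sequentially"
      by (rule filterlim_cong[OF refl refl radius, THEN iffD2])
    moreover have "(\<lambda>N. real (D N) / real N * (1 / c)) \<longlonglongrightarrow> 0 * (1 / c)"
      by (intro tendsto_mult smalloD_tendsto[OF D] tendsto_const)
    then have "(\<lambda>N. real (D N) / radius N (E N)) \<longlonglongrightarrow> 0"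
    proof (rule Lim_transform_eventually[THEN tendsto_eq_rhs])
      show "\<forall>\<^sub>F N in sequentially. real (D N) / real N * (1 / c) = real (D N) / radius N (E N)"
        using radius by eventually_elim (simp add: field_simps)
    qed simp
    ultimately show ?thesis by blast
  next
    assume pos: "\<forall>\<^sub>F N in sequentially. E N > 0"
      and ln2: "E \<in> \<omega>(\<lambda>N. (ln (real N))\<^sup>2)" and small: "E \<in> o(\<lambda>N. real N)"
      and D: "(\<lambda>N. real (D N)) \<in> o(\<lambda>N. E N / (ln (real N / E N))\<^sup>2)"
    \<comment> \<open>The constant 6 yields \<open>6 * ln N \<le> E\<close> once \<open>ln N\<close>
      is at least 1; the constant 1/4 below yields \<open>N / E \<ge> 4\<close>, so that
      \<open>ln (N / E)\<close> is at least 1.\<close>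
    have "\<forall>\<^sub>F N in sequentially. norm (E N) \<ge> 6 * norm ((ln (real N))\<^sup>2)"
      by (rule landau_omega.smallD[OF ln2]) simp
    moreover have "\<forall>\<^sub>F N in sequentially. norm (E N) \<le> 1 / 4 * norm (real N)"
      by (rule landau_o.smallD[OF small]) simp
    moreover have "\<forall>\<^sub>F N in sequentially. 1 \<le> ln (real N)" by real_asymp
    moreover have "\<forall>\<^sub>F N in sequentially. 4 \<le> real N" by real_asymp
    ultimately have ev: "\<forall>\<^sub>F N in sequentially. 0 < E N \<and> 6 * (ln (real N))\<^sup>2 \<le> E N \<and> 4 * E N \<le> real N
        \<and> 1 \<le> ln (real N) \<and> 4 \<le> real N"
      using pos by eventually_elim auto
    have main: "0 < E N \<and> E N < 4 * real N \<and> 6 * ln (real N) \<le> E N \<and> ln (real N) / 2 \<le> radius N (E N)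
        \<and> 0 < radius N (E N) \<and> ln (4 * real N / E N) \<le> 2 * (ln (real N / E N))\<^sup>2 \<and> 1 \<le> ln (real N / E N)"
      if N: "0 < E N" "6 * (ln (real N))\<^sup>2 \<le> E N" "4 * E N \<le> real N" "1 \<le> ln (real N)" "4 \<le> real N" for N
    proof -
      have sq: "ln (real N) \<le> (ln (real N))\<^sup>2"
        using N(4) by (simp add: power2_eq_square)
      have ln4: "1 \<le> ln (4::real)"
        using ln2_ge_two_thirds ln_realpow[of 2 2] by simp
      have "ln 4 \<le> ln (real N / E N)"
        using N by (subst ln_le_cancel_iff) (auto simp: field_simps)
      then have l: "ln 4 \<le> ln (real N / E N)" "1 \<le> ln (real N / E N)" using ln4 by linarith+
      have eq: "ln (4 * real N / E N) = ln 4 + ln (real N / E N)"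
        using N ln_mult[of 4 "real N / E N"] by simp
      have pos4: "0 < ln (4 * real N / E N)" using l ln4 eq by linarith
      have "ln (real N / E N) \<le> (ln (real N / E N))\<^sup>2"
        using l(2) by (simp add: power2_eq_square)
      \<comment> \<open>The factor 4 inside the logarithm at most doubles it, since
        \<open>ln 4 \<le> ln (N / E)\<close>. This passes from the logarithm in
        \<open>radius\<close> to the squared one in the hypothesis on \<open>D\<close>.\<close>
      then have log_le: "ln (4 * real N / E N) \<le> 2 * (ln (real N / E N))\<^sup>2"
        using eq l by linarith
      have "1 \<le> E N" using N(2,4) sq by linarith
      \<comment> \<open>The logarithm in \<open>radius\<close> is at most \<open>2 * ln N\<close>,
        so the radius is at least \<open>E / (8 * ln N)\<close>, which the lower bound on
        \<open>E\<close> keeps above \<open>ln N / 2\<close>.\<close>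
      have "4 * real N / E N \<le> 4 * real N / 1"
        using \<open>1 \<le> E N\<close> N by (intro divide_left_mono) auto
      also have "\<dots> \<le> real N * real N"
        using N(5) by simp
      finally have "ln (4 * real N / E N) \<le> ln (real N * real N)"
        using N by (subst ln_le_cancel_iff) auto
      also have "\<dots> = 2 * ln (real N)" using N by (simp add: ln_mult)
      finally have "ln (real N) / 2 * (4 * ln (4 * real N / E N)) \<le> ln (real N) / 2 * (4 * (2 * ln (real N)))"
        using N by (intro mult_left_mono) auto
      also have "\<dots> = 4 * (ln (real N))\<^sup>2" by (simp add: power2_eq_square)
      also have "\<dots> \<le> E N" using N(2) zero_le_power2[of "ln (real N)"] by linarith
      finally have "ln (real N) / 2 \<le> radius N (E N)"
        unfolding radius_def using pos4 by (simp add: pos_le_divide_eq)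
      moreover have "0 < radius N (E N)" unfolding radius_def using pos4 N by simp
      ultimately show ?thesis using N sq l log_le by auto
    qed
    have ev': "\<forall>\<^sub>F N in sequentially. 0 < E N \<and> E N < 4 * real N \<and> 6 * ln (real N) \<le> E N
        \<and> ln (real N) / 2 \<le> radius N (E N) \<and> 0 < radius N (E N)
        \<and> ln (4 * real N / E N) \<le> 2 * (ln (real N / E N))\<^sup>2 \<and> 1 \<le> ln (real N / E N)"
      using ev by eventually_elim (use main in blast)
    have "\<forall>\<^sub>F N in sequentially. 0 < E N \<and> E N < 4 * real N \<and> 6 * ln (real N) \<le> E N"
      using ev' by eventually_elim blast
    moreover have "filterlim (\<lambda>N. radius N (E N)) at_top sequentially"
    proof (rule filterlim_at_top_mono)
      show "filterlim (\<lambda>N. ln (real N) / 2) at_top sequentially" by real_asymp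
      show "\<forall>\<^sub>F N in sequentially. ln (real N) / 2 \<le> radius N (E N)"
        using ev' by eventually_elim blast
    qed
    moreover have "(\<lambda>N. real (D N) / radius N (E N)) \<longlonglongrightarrow> 0"
    proof (rule tendstoI)
      fix \<epsilon> :: real assume \<epsilon>: "\<epsilon> > 0"
      \<comment> \<open>\<open>E / l\<close> will be at most 8 times the radius, so 1/16 leaves half
        of \<epsilon> as a strict margin.\<close>
      have "\<forall>\<^sub>F N in sequentially. norm (real (D N)) \<le> \<epsilon> / 16 * norm (E N / (ln (real N / E N))\<^sup>2)"
        using \<epsilon> by (intro landau_o.smallD[OF D]) simp
      then show "\<forall>\<^sub>F N in sequentially. dist (real (D N) / radius N (E N)) 0 < \<epsilon>"
        using ev'
      proof eventually_elim
        case (elim N)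
        define l where "l = (ln (real N / E N))\<^sup>2"
        have l: "0 < l" using elim unfolding l_def by (intro zero_less_power) linarith
        have "real (D N) \<le> \<epsilon> / 16 * (E N / l)" using elim by (simp add: l_def)
        moreover have "radius N (E N) * (8 * l) \<ge> E N"
        proof -
          have "E N = radius N (E N) * (4 * ln (4 * real N / E N))"
            using elim unfolding radius_def by auto
          also have "\<dots> \<le> radius N (E N) * (8 * l)"
            using elim by (intro mult_left_mono) (auto simp: l_def)
          finally show ?thesis .
        qed
        then have "E N / l \<le> radius N (E N) * 8" using l by (simp add: field_simps)
        then have "\<epsilon> / 16 * (E N / l) \<le> \<epsilon> / 16 * (radius N (E N) * 8)"
          using \<epsilon> by (intro mult_left_mono) auto
        ultimately have "real (D N) \<le> \<epsilon> / 2 * radius N (E N)" by simp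
        also have "\<dots> < \<epsilon> * radius N (E N)" using \<epsilon> elim by simp
        finally show ?case using elim by (simp add: field_simps)
      qed
    qed
    ultimately show ?thesis by blast
  qed
  then show "\<forall>\<^sub>F N in sequentially. 0 < E N \<and> E N < 4 * real N \<and> 6 * ln (real N) \<le> E N"
    and "filterlim (\<lambda>N. radius N (E N)) at_top sequentially"
    and "(\<lambda>N. real (D N) / radius N (E N)) \<longlonglongrightarrow> 0"
    by blast+
qed

section \<open>Choice of \<open>M\<close> and passage to the limit\<close>

theorem theorem1p4:
  fixes C :: real
    and D :: "nat \<Rightarrow> nat"
    and E :: "nat \<Rightarrow> real"
    and A :: "nat \<Rightarrow> (nat \<Rightarrow> real) \<Rightarrow> (nat \<Rightarrow> real)"
  assumes "C > 0"
    and "\<And>N. N \<ge> 1 \<Longrightarrow> coord_degree_algorithm N (D N) (A N)"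
    and "\<And>N. N \<ge> 1 \<Longrightarrow> (\<integral>g. (L2_set (A N g) {1..N})\<^sup>2 \<partial>gauss N) \<le> C * real N"
    and "(\<exists>\<delta>::real. 0 < \<delta> \<and> \<delta> < 1 \<and> (\<forall>N\<ge>1. E N = \<delta> * real N) \<and>
             (\<lambda>N. real (D N)) \<in> o(\<lambda>N. real N))
       \<or> ((\<forall>\<^sub>F N in sequentially. E N > 0) \<and>
             E \<in> \<omega>(\<lambda>N. (ln (real N))\<^sup>2) \<and> E \<in> o(\<lambda>N. real N) \<and>
             (\<lambda>N. real (D N)) \<in> o(\<lambda>N. E N / (ln (real N / E N))\<^sup>2))"
  shows "(\<lambda>N. success_prob N (A N) (E N)) \<longlonglongrightarrow> 0"
proof (rule tendstoI)
  fix \<epsilon> :: real assume \<epsilon>: "\<epsilon> > 0"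
  note asym = energy_asymptotics[OF assms(4)]
  have ev1: "\<forall>\<^sub>F N in sequentially. N \<ge> (1::nat)" by (rule eventually_ge_at_top)
  \<comment> \<open>\<open>2 / M\<close> is the one term of the bound that does not vanish as
    \<open>N\<close> grows; this makes it half of \<epsilon>.\<close>
  define M where "M = 4 / \<epsilon>"
  have M: "M > 0" "2 / M = \<epsilon> / 2" using \<epsilon> by (auto simp: M_def)
  have E_top: "filterlim E at_top sequentially"
  proof (rule filterlim_at_top_mono)
    show "filterlim (\<lambda>N. 6 * ln (real N)) at_top sequentially" by real_asymp
    show "\<forall>\<^sub>F N in sequentially. 6 * ln (real N) \<le> E N"
      using asym(1) by eventually_elim blast
  qed
  \<comment> \<open>From \<open>6 * ln N \<le> E\<close> and \<open>ln 2\<close> at least 2/3, the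
    tolerance is at most \<open>1 / N ^ 4\<close>, which outweighs the quadratic number of
    coordinate pairs.\<close>
  have bad: "(\<lambda>N. 2 * (real N)\<^sup>2 * 2 powr (- E N)) \<longlonglongrightarrow> 0"
  proof (rule tendsto_sandwich)
    show "\<forall>\<^sub>F N in sequentially. 0 \<le> 2 * (real N)\<^sup>2 * 2 powr (- E N)" by simp
    show "(\<lambda>N. 2 / (real N)\<^sup>2) \<longlonglongrightarrow> 0" by real_asymp
    show "\<forall>\<^sub>F N in sequentially. 2 * (real N)\<^sup>2 * 2 powr (- E N) \<le> 2 / (real N)\<^sup>2"
      using asym(1) ev1
    proof eventually_elim
      case (elim N)
      have "E N * (2 / 3) \<le> E N * ln 2"
        using elim ln2_ge_two_thirds by (intro mult_left_mono) auto
      with elim have "- (E N * ln 2) \<le> - 4 * ln (real N)" by linarith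
      then have "2 powr (- E N) \<le> exp (- 4 * ln (real N))"
        by (simp add: powr_def)
      also have "\<dots> = 1 / (real N) ^ 4"
        using elim by (simp add: exp_minus exp_of_nat_mult[of 4 "ln (real N)", simplified] divide_inverse)
      finally have "2 * (real N)\<^sup>2 * 2 powr (- E N) \<le> 2 * (real N)\<^sup>2 * (1 / (real N) ^ 4)"
        by (intro mult_left_mono) auto
      also have "\<dots> = 2 / (real N)\<^sup>2"
        using elim by (simp add: field_simps power2_eq_square power4_eq_xxxx)
      finally show ?case .
    qed
  qed simp
  have "(\<lambda>N. exp (- (E N / 6))) \<longlonglongrightarrow> 0"
    by (rule filterlim_compose[OF _ E_top]) real_asymp
  then have "(\<lambda>N. 2 * (real N)\<^sup>2 * 2 powr (- E N) + 2 / M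
      + sqrt (16 * C * (real (D N) / radius N (E N)) + exp (- (E N / 6)))) \<longlonglongrightarrow> 0 + 2 / M + sqrt (16 * C * 0 + 0)"
    by (intro tendsto_add bad tendsto_const tendsto_real_sqrt tendsto_mult asym(3))
  then have "\<forall>\<^sub>F N in sequentially. 2 * (real N)\<^sup>2 * 2 powr (- E N) + 2 / M
      + sqrt (16 * C * (real (D N) / radius N (E N)) + exp (- (E N / 6))) < \<epsilon>"
    by (rule order_tendstoD(2)) (use M \<epsilon> in simp)
  \<comment> \<open>\<open>M\<close> is fixed while the radius grows, so the size condition of
    \<open>success_prob_le_radius\<close> holds eventually.\<close>
  moreover have "\<forall>\<^sub>F N in sequentially. 2 * (M\<^sup>2 + 4 * M) \<le> radius N (E N)"
    using asym(2) by (simp add: filterlim_at_top)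
  ultimately show "\<forall>\<^sub>F N in sequentially. dist (success_prob N (A N) (E N)) 0 < \<epsilon>"
    using asym(1) ev1
  proof eventually_elim
    case (elim N)
    have "M\<^sup>2 + 4 * M \<le> radius N (E N) / 2" "0 < E N" "E N < 4 * real N"
      using elim by auto
    from success_prob_le_radius[OF elim(4) assms(2)[OF elim(4)] assms(1) assms(3)[OF elim(4)] this(2,3) M(1) this(1)]
    have "success_prob N (A N) (E N) < \<epsilon>"
      using elim(1) by linarith
    moreover have "0 \<le> success_prob N (A N) (E N)" by (simp add: success_prob_def)
    ultimately show ?case by simp
  qed
qed

end
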